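(* Let $L$ and $M$ be two $m\times n$ complex matrix pencils with $\operatorname{rank} M\leq \operatorname{rank} L$, and set $h:=\operatorname{rank} L-\operatorname{rank} M$. Suppose that the following three majorization relationships are satisfied: (M1) $r(M)\prec_{\rm w} r(L)+(h,h,\ldots)$; (M2) $\ell(M)\prec_{\rm w} \ell(L)+(h,h,\ldots)$; (M3) $W(\mu,L)\prec_{\rm w} W(\mu,M)+(h,h,\ldots)$ for all $\mu\in\overline{\mathbb C}$. Then $$\operatorname{codim}\mathcal O(L)\leq \operatorname{codim}\mathcal O(M),$$ where $\operatorname{codim}\mathcal O(\cdot)$ denotes the codimension of the orbit under strict equivalence, given by the formula stated in the context. Moreover, equality holds in this inequality if and only if $h=0$ and (M1)–(M3) hold with "$\prec_{\rm w}$" replaced by "$=$", i.e. $h=0$, $r(M)=r(L)$, $\ell(M)=\ell(L)$, and $W(\mu,L)=W(\mu,M)$ for all $\mu\in\overline{\mathbb C}$.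
   Context: An $m\times n$ matrix pencil is $L=A+\lambda B$ with $A,B\in\mathbb C^{m\times n}$ and $\lambda$ an indeterminate; the space of such pencils is identified with $\mathbb C^{m\times n}\times\mathbb C^{m\times n}$. Set $\overline{\mathbb C}:=\mathbb C\cup\{\infty\}$. The rank of a pencil, $\operatorname{rank} L$, is its rank as a matrix over the field $\mathbb C(\lambda)$. The orbit of $L$ under strict equivalence is $\mathcal O(L)=\{PLQ:\ P\in\mathbb C^{m\times m},\ Q\in\mathbb C^{n\times n}\text{ invertible}\}$. Kronecker canonical form (KCF). Every pencil is strictly equivalent to a block diagonal pencil, unique up to permutation of the diagonal blocks, whose diagonal blocks are of the following types: (1) Jordan blocks $J_k(\mu)$ of size $k\times k$, $k\geq1$, with eigenvalue $\mu\in\overline{\mathbb C}$ (for $\mu\in\mathbb C$, $J_k(\mu)=(\lambda-\mu)I_k+N_k$; for $\mu=\infty$, $J_k(\infty)=I_k+\lambda N_k$, where $N_k$ is the $k\times k$ matrix with ones on the first superdiagonal and zeros elsewhere); (2) right singular blocks $L_k$ of size $k\times(k+1)$, $k\geq0$, where $L_k$ has entries $\lambda$ in positions $(i,i)$, $1$ in positions $(i,i+1)$, and $0$ elsewhere; (3) left singular blocks $L_k^\top$ of size $(k+1)\times k$, $k\geq0$. ($L_0$ is a $0\times1$ block, contributing a zero column, and $L_0^\top$ contributes a zero row.) Weyr characteristics. For a pencil $L$: - $r(L)=(r_0(L),r_1(L),r_2(L),\ldots)$, where $r_i(L)$ is the number of right singular blocks $L_k$ in the KCF of $L$ (counted with multiplicity)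 with $k\geq i$; - $\ell(L)=(\ell_0(L),\ell_1(L),\ell_2(L),\ldots)$, where $\ell_i(L)$ is the number of left singular blocks $L_k^\top$ in the KCF of $L$ with $k\geq i$; - for $\mu\in\overline{\mathbb C}$, $W(\mu,L)=(W_1(\mu,L),W_2(\mu,L),\ldots)$, where $W_i(\mu,L)$ is the number of Jordan blocks $J_k(\mu)$ in the KCF of $L$ with $k\geq i$ (so $W_i(\mu,L)=0$ for all $i\geq1$ if $\mu$ is not an eigenvalue of $L$). All these lists are regarded as infinite lists having finitely many nonzero entries. Sums of lists are entrywise, and $(h,h,\ldots)$ is the infinite constant list. Weak majorization. For non-increasingly ordered lists of integers $\mathcal M=(m_1,m_2,\ldots)$ and $\mathcal N=(n_1,n_2,\ldots)$, $\mathcal M\prec_{\rm w}\mathcal N$ means $m_1+\cdots+m_j\leq n_1+\cdots+n_j$ for all $j\geq1$ (for lists indexed from $0$, the partial sums start at the entry of index $0$). Codimension formula. For an $m\times n$ pencil $L$, the codimension of $\mathcal O(L)$ (as a manifold in $\mathbb C^{m\times n}\times\mathbb C^{m\times n}$) is given by $$\operatorname{codim}\mathcal O(L)=\ell_0(L)\,n+r_0(L)\,m-\sum_{i\geq0}r_i(L)r_{i+1}(L)-\sum_{i\geq0}\ell_i(L)\ell_{i+1}(L)+\sum_{\lambda\in\overline{\mathbb C}}\sum_{i\geq1}W_i(\lambda,L)^2 .$$ Only finitely many terms in these sums are nonzero. *)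

theory Defs
  imports
    "Jordan_Normal_Form.Jordan_Normal_Form"
    "Jordan_Normal_Form.DL_Rank"
    "HOL-Library.Groups_Big_Fun"
begin

text \<open>The pair \<open>(A, B)\<close> stands for the matrix pencil \<open>A + \<lambda> B\<close>.\<close>

type_synonym pencil = "complex mat \<times> complex mat"

definition pencils :: "nat \<Rightarrow> nat \<Rightarrow> pencil set" where
  "pencils m n = carrier_mat m n \<times> carrier_mat m n"

definition nrows :: "pencil \<Rightarrow> nat" where
  "nrows L = dim_row (fst L)"

definition ncols :: "pencil \<Rightarrow> nat" where
  "ncols L = dim_col (fst L)"

definition rational_mat :: "pencil \<Rightarrow> complex poly fract mat" where
  "rational_mat L =
     mat (nrows L) (ncols L) (\<lambda>(i, j). to_fract [:fst L $$ (i, j), snd L $$ (i, j):])"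

definition pencil_rank :: "pencil \<Rightarrow> nat" where
  "pencil_rank L = vec_space.rank (nrows L) (rational_mat L)"

definition strict_orbit :: "pencil \<Rightarrow> pencil set" where
  "strict_orbit L =
     {(P * fst L * Q, P * snd L * Q) | P Q.
        P \<in> carrier_mat (nrows L) (nrows L) \<and> invertible_mat P \<and>
        Q \<in> carrier_mat (ncols L) (ncols L) \<and> invertible_mat Q}"


text \<open>The extended complex plane.\<close>

datatype ecomplex = Finite complex | Infinity

text \<open>
  \<open>Jordan k \<mu>\<close>, \<open>RSing k\<close> and \<open>LSing k\<close> are the blocks \<open>J\<^sub>k(\<mu>)\<close>, \<open>L\<^sub>k\<close> and the
  transpose of \<open>L\<^sub>k\<close>.  Note that \<open>jordan_block k 0\<close> is the nilpotent matrix \<open>N\<^sub>k\<close>, and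
  \<open>jordan_block k (- \<mu>)\<close> is \<open>N\<^sub>k - \<mu> I\<^sub>k\<close>.
\<close>

datatype kblock = Jordan nat ecomplex | RSing nat | LSing nat

fun block_pencil :: "kblock \<Rightarrow> pencil" where
  "block_pencil (Jordan k (Finite \<mu>)) = (jordan_block k (- \<mu>), 1\<^sub>m k)"
| "block_pencil (Jordan k Infinity) = (1\<^sub>m k, jordan_block k 0)"
| "block_pencil (RSing k) =
     (mat k (k + 1) (\<lambda>(i, j). if j = i + 1 then 1 else 0),
      mat k (k + 1) (\<lambda>(i, j). if j = i then 1 else 0))"
| "block_pencil (LSing k) =
     (mat (k + 1) k (\<lambda>(i, j). if i = j + 1 then 1 else 0),
      mat (k + 1) k (\<lambda>(i, j). if i = j then 1 else 0))"

definition diag_pencil :: "kblock list \<Rightarrow> pencil" where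
  "diag_pencil bs =
     (diag_block_mat (map (fst \<circ> block_pencil) bs),
      diag_block_mat (map (snd \<circ> block_pencil) bs))"

definition is_kcf :: "pencil \<Rightarrow> kblock list \<Rightarrow> bool" where
  "is_kcf L bs \<longleftrightarrow>
     (\<forall>k \<mu>. Jordan k \<mu> \<in> set bs \<longrightarrow> k \<ge> 1) \<and> diag_pencil bs \<in> strict_orbit L"

text \<open>
  By Kronecker's theorem such a list of blocks exists and is unique up to permutation, so the
  numbers of blocks below do not depend on the choice.
\<close>

definition kcf :: "pencil \<Rightarrow> kblock list" where
  "kcf L = (SOME bs. is_kcf L bs)"


text \<open>
  The Weyr characteristics, as integer sequences.  \<open>r_weyr\<close> and \<open>l_weyr\<close> are indexed from 0;
  \<open>W_weyr \<mu> L\<close> is indexed from 1, and its value at index 0 is irrelevant.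
\<close>

definition r_weyr :: "pencil \<Rightarrow> nat \<Rightarrow> int" where
  "r_weyr L i = int (length (filter (\<lambda>b. \<exists>k\<ge>i. b = RSing k) (kcf L)))"

definition l_weyr :: "pencil \<Rightarrow> nat \<Rightarrow> int" where
  "l_weyr L i = int (length (filter (\<lambda>b. \<exists>k\<ge>i. b = LSing k) (kcf L)))"

definition W_weyr :: "ecomplex \<Rightarrow> pencil \<Rightarrow> nat \<Rightarrow> int" where
  "W_weyr \<mu> L i = int (length (filter (\<lambda>b. \<exists>k\<ge>i. b = Jordan k \<mu>) (kcf L)))"

text \<open>Weak majorization of lists whose first entry has index \<open>s\<close>.\<close>

definition weak_major :: "nat \<Rightarrow> (nat \<Rightarrow> int) \<Rightarrow> (nat \<Rightarrow> int) \<Rightarrow> bool" where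
  "weak_major s M N \<longleftrightarrow> (\<forall>j\<ge>s. (\<Sum>i=s..j. M i) \<le> (\<Sum>i=s..j. N i))"

text \<open>
  The codimension of the orbit of a pencil, by the standard formula in terms of the Kronecker
  canonical form.  \<open>Sum_any\<close> sums over the (finite) support of its argument.
\<close>

definition orbit_codim :: "pencil \<Rightarrow> int" where
  "orbit_codim L =
     l_weyr L 0 * int (ncols L) + r_weyr L 0 * int (nrows L)
     - Sum_any (\<lambda>i. r_weyr L i * r_weyr L (i + 1))
     - Sum_any (\<lambda>i. l_weyr L i * l_weyr L (i + 1))
     + Sum_any (\<lambda>\<mu>. Sum_any (\<lambda>i. if i \<ge> 1 then (W_weyr \<mu> L i)\<^sup>2 else 0))"

end

theory Submission
  imports Defs "HOL-Library.Function_Algebras"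
begin

text \<open>
  The statement combines two facts.  First, the lists \<open>r\<close>, \<open>\<ell>\<close> and \<open>W\<close> really are read off a
  Kronecker canonical form of the pencil, so that they determine its rank and its size.  Second,
  once this is known, the claim is an inequality between integer sequences.

  \<^emph>\<open>Canonical forms.\<close>  A pencil is a pair of linear maps \<open>A, B: V \<rightarrow> W\<close>, and a canonical block is
  a pair of chains of vectors in \<open>V\<close> and \<open>W\<close> along which \<open>A\<close> and \<open>B\<close> act by shifts.  Kronecker's
  theorem says that \<open>V\<close> and \<open>W\<close> have bases composed of such chains.  It follows by induction on
  dimensions from two reductions, both of which lengthen chains of a smaller pencil by one vector.

  If \<open>B\<close> is not onto \<open>W\<close>, restrict to \<open>W' = B V\<close> and \<open>V' = {v. A v \<in> W'}\<close>.  The images under \<open>B\<close>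
  of the chains of \<open>(V', W')\<close> miss exactly the last vectors \<open>w\<close> of the chains of type \<open>J(\<infinity>)\<close> and
  \<open>L\<^sup>T\<close>.  As \<open>w \<in> B V\<close>, there is \<open>u\<close> with \<open>B u = w\<close>, and \<open>u\<close>, \<open>A u\<close> prolong the chain.  What is left
  of \<open>V\<close> is spanned by vectors of \<open>ker B\<close>, which start new chains \<open>J\<^sub>1(\<infinity>)\<close>, and what is left of \<open>W\<close>
  gives blocks \<open>L\<^sub>0\<^sup>T\<close> (\<open>preimage_step\<close>, \<open>kronecker_decomposition\<close>).  If \<open>B\<close> is onto but not
  injective, pass instead to the quotients by \<open>ker B\<close> and \<open>A (ker B)\<close>; lifting the chains back
  prolongs every chain of type \<open>L\<close> (\<open>kernel_step\<close>, \<open>decomposition_surjective\<close>).  If \<open>B\<close> is bijective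
  and \<open>W \<noteq> 0\<close>, some \<open>A + \<mu>B\<close> is not onto, and the first reduction, applied to the pair \<open>(B, A + \<mu>B)\<close>, prolongs
  the Jordan chains with eigenvalue \<open>-\<mu>\<close> of \<open>A\<close> relative to \<open>B\<close> (\<open>decomposition_bijective\<close>).

  \<^emph>\<open>The inequality.\<close>  The canonical form gives \<open>r\<^sub>0 = n - rank\<close>, \<open>\<ell>\<^sub>0 = m - rank\<close> and
  \<open>rank = \<Sum>\<^sub>i\<^sub>\<ge>\<^sub>1 r\<^sub>i + \<Sum>\<^sub>i\<^sub>\<ge>\<^sub>1 \<ell>\<^sub>i + \<Sum>\<^sub>\<mu> \<Sum>\<^sub>i W\<^sub>i(\<mu>)\<close> (\<open>kcf_sizes\<close>, \<open>count_sums\<close>).  With these identities the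
  difference of the codimensions becomes
  \<open>codim O(M) - codim O(L) = G\<^sub>r + G\<^sub>\<ell> + \<Sum>\<^sub>\<mu> G\<^sub>W(\<mu>) - h\<^sup>2\<close>, where each \<open>G\<close> involves only one of the
  lists.  Summation by parts turns each majorization into a lower bound: \<open>G\<^sub>W(\<mu>) \<ge> 0\<close>
  (\<open>weyr_squares_gain\<close>) and \<open>G\<^sub>r, G\<^sub>\<ell> \<ge> h\<^sup>2\<close> (\<open>weyr_products_gain\<close>).  Hence the difference is at least
  \<open>h\<^sup>2\<close>.  If it vanishes, then \<open>h = 0\<close> and all three bounds are attained, which forces the lists to
  agree.
\<close>

section \<open>Bases of subspaces\<close>

lemma list_preimage:
  assumes "set ys \<subseteq> f ` A"
  shows "\<exists>xs. map f xs = ys \<and> set xs \<subseteq> A"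
  using assms
proof (induction ys)
  case (Cons y ys)
  then obtain x xs where "y = f x" "x \<in> A" "map f xs = ys" "set xs \<subseteq> A" by auto
  then show ?case by (intro exI[of _ "x # xs"]) simp
qed simp

locale subspace_bases = vector_space scale
  for scale :: "'a::field \<Rightarrow> 'b::ab_group_add \<Rightarrow> 'b" (infixr \<open>*s\<close> 75)
begin

text \<open>
  The ambient space may have infinite dimension, so finite dimension is a property of subspaces.
\<close>

definition fin_dim :: "'b set \<Rightarrow> bool" where
  "fin_dim V \<longleftrightarrow> (\<exists>xs. span (set xs) = V)"

text \<open>
  Bases are lists because they arise as concatenations of ordered chains.
\<close>

definition basis_list :: "'b set \<Rightarrow> 'b list \<Rightarrow> bool" where
  "basis_list V xs \<longleftrightarrow> distinct xs \<and> independent (set xs) \<and> span (set xs) = V"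

lemma fin_dim_span: "fin_dim (span (set xs))"
  by (auto simp: fin_dim_def)

lemma fin_dim_subspace: "fin_dim V \<Longrightarrow> subspace V"
  by (auto simp: fin_dim_def)

lemma basis_list_span: "basis_list V xs \<Longrightarrow> span (set xs) = V"
  by (simp add: basis_list_def)

lemma basis_list_subset: "basis_list V xs \<Longrightarrow> set xs \<subseteq> V"
  by (auto simp: basis_list_def span_base)

lemma basis_list_fin_dim: "basis_list V xs \<Longrightarrow> fin_dim V"
  by (auto simp: basis_list_def fin_dim_def)

lemma basis_list_length: "basis_list V xs \<Longrightarrow> length xs = dim V"
  by (metis basis_list_def dim_span_eq_card_independent distinct_card)

lemma basis_list_mset: "basis_list V xs \<Longrightarrow> mset xs = mset ys \<Longrightarrow> basis_list V ys"
  by (metis basis_list_def mset_eq_setD distinct_count_atmost_1)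

lemma basis_list_appendD: "basis_list V (xs @ ys) \<Longrightarrow> basis_list (span (set ys)) ys"
  by (auto simp: basis_list_def dest: independent_mono[OF _ Un_upper2])

lemma dim_span_list_le: "dim (span (set xs)) \<le> length xs"
  by (metis card_length dim_le_card le_trans List.finite_set order_refl)

lemma basis_list_extend:
  assumes "basis_list S xs" "S \<subseteq> V" "fin_dim V"
  obtains ys where "basis_list V (xs @ ys)"
proof -
  from assms(3) obtain zs where zs: "span (set zs) = V" by (auto simp: fin_dim_def)
  have "set xs \<subseteq> V" using assms basis_list_subset by blast
  moreover have ind: "independent (set xs)" using assms by (simp add: basis_list_def)
  ultimately obtain B where B: "set xs \<subseteq> B" "B \<subseteq> V" "independent B" "V \<subseteq> span B"
    using maximal_independent_subset_extend by metis
  have "finite B"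
    using independent_span_bound[OF _ B(3), of "set zs"] B(2) zs by auto
  then obtain ys where ys: "set ys = B - set xs" "distinct ys"
    using finite_distinct_list[of "B - set xs"] by auto
  have "set (xs @ ys) = B" using ys B by auto
  moreover have "span B = V"
    using B fin_dim_subspace[OF assms(3)] by (simp add: span_subspace)
  ultimately have "basis_list V (xs @ ys)"
    using ys assms(1) B(3) unfolding basis_list_def by (metis Diff_disjoint distinct_append)
  then show ?thesis by (rule that)
qed

lemma basis_list_exists:
  assumes "fin_dim V" obtains xs where "basis_list V xs"
proof -
  have "basis_list {0} []" by (simp add: basis_list_def independent_empty)
  moreover have "{0} \<subseteq> V" using fin_dim_subspace[OF assms] subspace_0 by auto
  ultimately show ?thesis using basis_list_extend[of "{0}" "[]"] assms that by auto
qed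

lemma fin_dim_subset:
  assumes "fin_dim V" "subspace S" "S \<subseteq> V"
  shows "fin_dim S"
proof -
  from assms(1) obtain zs where zs: "span (set zs) = V" by (auto simp: fin_dim_def)
  obtain B where B: "B \<subseteq> S" "independent B" "S \<subseteq> span B"
    using maximal_independent_subset by metis
  have "finite B" using independent_span_bound[OF _ B(2), of "set zs"] B(1) assms(3) zs by auto
  then obtain ys where "set ys = B" using finite_list by auto
  moreover have "span B = S" using B assms(2) by (simp add: span_subspace)
  ultimately show ?thesis by (auto simp: fin_dim_def)
qed

lemma dim_subspace_le:
  assumes "fin_dim V" "subspace S" "S \<subseteq> V"
  shows "dim S \<le> dim V"
proof -
  obtain xs where xs: "basis_list S xs" using fin_dim_subset[OF assms] basis_list_exists by blast
  then obtain ys where "basis_list V (xs @ ys)" using basis_list_extend assms by blast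
  then have "length (xs @ ys) = dim V" by (rule basis_list_length)
  then show ?thesis using basis_list_length[OF xs] by simp
qed

lemma subspace_eqI_dim:
  assumes "fin_dim V" "subspace S" "S \<subseteq> V" "dim V \<le> dim S"
  shows "S = V"
proof -
  obtain xs where xs: "basis_list S xs" using fin_dim_subset[OF assms(1-3)] basis_list_exists by blast
  then obtain ys where ys: "basis_list V (xs @ ys)" using basis_list_extend assms by blast
  have "length (xs @ ys) = dim V" "length xs = dim S" using xs ys by (blast intro: basis_list_length)+
  then have "length ys = 0" using assms(4) length_append[of xs ys] by linarith
  then have "ys = []" by simp
  then show ?thesis using xs ys by (simp add: basis_list_def)
qed

text \<open>
  A maximal independent part of \<open>xs\<close> has \<open>dim V\<close> elements already, so it is all of \<open>xs\<close>, and nothing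
  occurs twice.  This reduces the verification of a basis to spanning and counting.
\<close>

lemma basis_listI:
  assumes "span (set xs) = V" "length xs \<le> dim V"
  shows "basis_list V xs"
proof -
  obtain B where B: "B \<subseteq> set xs" "independent B" "set xs \<subseteq> span B"
    using maximal_independent_subset[of "set xs"] by metis
  have "span B = V" using B assms(1) by (metis span_eq span_superset subset_trans)
  then have "card B = dim V" using B(2) by (metis dim_span_eq_card_independent)
  then have "B = set xs" "card (set xs) = length xs"
    using assms(2) B(1) card_length[of xs] card_mono[OF _ B(1)]
    by (metis List.finite_set card_subset_eq le_antisym le_trans)+
  then show ?thesis using B \<open>span B = V\<close> by (simp add: basis_list_def card_distinct)
qed

lemma span_list:
  assumes "v \<in> span (set xs)"
  shows "\<exists>c. v = (\<Sum>i<length xs. scale (c i) (xs ! i))"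
  using assms
proof (induction rule: span_induct_alt)
  case base
  show ?case by (rule exI[of _ "\<lambda>_. 0"]) simp
next
  case (step a x y)
  then obtain c where c: "y = (\<Sum>i<length xs. scale (c i) (xs ! i))" by blast
  from step(1) obtain k where k: "k < length xs" "x = xs ! k" by (metis in_set_conv_nth)
  have "scale a x + y = (\<Sum>i<length xs. scale ((if i = k then a else 0) + c i) (xs ! i))"
    using k by (simp add: scale_left_distrib sum.distrib c if_distrib[of "\<lambda>t. scale t _"] sum.delta cong: if_cong)
  then show ?case by (intro exI[of _ "\<lambda>i. (if i = k then a else 0) + c i"])
qed

lemma sum_in_span_list: "(\<Sum>i<length xs. scale (c i) (xs ! i)) \<in> span (set xs)"
  by (intro span_sum span_scale span_base) auto

lemma basis_list_sum_eq_0: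
  assumes "basis_list V xs" "(\<Sum>i<length xs. scale (c i) (xs ! i)) = 0" "i < length xs"
  shows "c i = 0"
proof -
  have d: "distinct xs" "independent (set xs)" using assms(1) by (auto simp: basis_list_def)
  define k where "k x = c (the_inv_into {..<length xs} ((!) xs) x)" for x
  have bij: "bij_betw ((!) xs) {..<length xs} (set xs)"
    using d(1) bij_betw_nth by blast
  have k: "k (xs ! j) = c j" if "j < length xs" for j
    using that bij unfolding k_def by (metis bij_betw_def lessThan_iff the_inv_into_f_f)
  have "(\<Sum>x\<in>set xs. scale (k x) x) = (\<Sum>j<length xs. scale (k (xs ! j)) (xs ! j))"
    using sum.reindex_bij_betw[OF bij, of "\<lambda>x. scale (k x) x"] by simp
  also have "\<dots> = 0" using assms(2) k by simp
  finally have "k (xs ! i) = 0"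
    using independentD[OF d(2), of "set xs" k "xs ! i"] assms(3) by simp
  then show ?thesis using k assms(3) by simp
qed

text \<open>
  The image \<open>p ` W\<close> is a copy of the quotient of \<open>W\<close> by \<open>D\<close> inside \<open>W\<close>.  Working with projections
  keeps an induction over quotients within one type.
\<close>

lemma projection_along:
  assumes "subspace D" "subspace W" "D \<subseteq> W"
  obtains p where "Vector_Spaces.linear scale scale p" "\<And>d. d \<in> D \<Longrightarrow> p d = 0"
    "\<And>w. w \<in> W \<Longrightarrow> p w \<in> W \<and> w - p w \<in> D"
proof -
  interpret self: vector_space_pair scale scale ..
  obtain B where B: "B \<subseteq> D" "independent B" "D \<subseteq> span B"
    using maximal_independent_subset by metis
  obtain B' where B': "B \<subseteq> B'" "B' \<subseteq> W" "independent B'" "W \<subseteq> span B'"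
    using maximal_independent_subset_extend[of B W] B assms(3) by blast
  obtain p where p: "Vector_Spaces.linear scale scale p"
    and pB: "\<forall>x\<in>B'. p x = (if x \<in> B then 0 else x)"
    using self.linear_independent_extend[OF B'(3), of "\<lambda>x. if x \<in> B then 0 else x"] by auto
  interpret p: Vector_Spaces.linear scale scale p by fact
  have "p d = 0" if "d \<in> D" for d
    by (rule p.eq_0_on_span[of B]) (use B(3) pB B'(1) that in auto)
  moreover have "p w \<in> W \<and> w - p w \<in> D" if "w \<in> W" for w
  proof -
    have "w \<in> span B'" using that B' by auto
    then show ?thesis
    proof (induction rule: span_induct_alt)
      case base
      then show ?case using assms by (simp add: subspace_0)
    next
      case (step c x y)
      have 1: "p x \<in> W" "x - p x \<in> D"
        using step(1) pB B' B assms by (auto simp: subspace_0)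
      have "p (scale c x + y) = scale c (p x) + p y" by (simp add: p.add p.scale)
      moreover have "scale c x + y - (scale c (p x) + p y) = scale c (x - p x) + (y - p y)"
        by (simp add: algebra_simps)
      ultimately show ?case
        using step 1 assms by (metis subspace_add subspace_scale)
    qed
  qed
  ultimately show ?thesis using p that by blast
qed

end

locale subspace_bases_pair = vs1: subspace_bases s1 + vs2: subspace_bases s2
  for s1 :: "'a::field \<Rightarrow> 'b::ab_group_add \<Rightarrow> 'b" (infixr \<open>*a\<close> 75)
  and s2 :: "'a::field \<Rightarrow> 'c::ab_group_add \<Rightarrow> 'c" (infixr \<open>*b\<close> 75)
begin

sublocale vector_space_pair s1 s2 ..


lemma fin_dim_image:
  assumes "Vector_Spaces.linear s1 s2 f" "vs1.fin_dim V"
  shows "vs2.fin_dim (f ` V)"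
proof -
  interpret f: Vector_Spaces.linear s1 s2 f by fact
  from assms(2) obtain zs where zs: "vs1.span (set zs) = V" by (auto simp: vs1.fin_dim_def)
  have "vs2.span (set (map f zs)) = f ` V" using zs f.span_image[of "set zs"] by simp
  then show ?thesis unfolding vs2.fin_dim_def by blast
qed

lemma subspace_kernel_on:
  assumes "Vector_Spaces.linear s1 s2 f" "vs1.subspace V"
  shows "vs1.subspace {v \<in> V. f v = 0}"
proof -
  interpret f: Vector_Spaces.linear s1 s2 f by fact
  show ?thesis using assms(2) by (auto simp: vs1.subspace_def f.add f.scale)
qed

lemma rank_nullity:
  assumes "Vector_Spaces.linear s1 s2 f" "vs1.fin_dim V"
  shows "vs1.dim V = vs1.dim {v \<in> V. f v = 0} + vs2.dim (f ` V)"
proof -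
  interpret f: Vector_Spaces.linear s1 s2 f by fact
  let ?K = "{v \<in> V. f v = 0}"
  have sV: "vs1.subspace V" using assms(2) by (rule vs1.fin_dim_subspace)
  have sK: "vs1.subspace ?K" using assms(1) sV by (rule subspace_kernel_on)
  have fK: "vs1.fin_dim ?K" using assms(2) sK by (rule vs1.fin_dim_subset) auto
  obtain ks where ks: "vs1.basis_list ?K ks" using fK by (rule vs1.basis_list_exists)
  obtain xs where xs: "vs1.basis_list V (ks @ xs)"
    by (rule vs1.basis_list_extend[OF ks _ assms(2)]) auto
  have indep: "vs1.independent (set ks \<union> set xs)" and disj: "set ks \<inter> set xs = {}"
    and dist: "distinct xs" and sp: "vs1.span (set ks \<union> set xs) = V"
    using xs by (auto simp: vs1.basis_list_def)
  have inj: "inj_on f (vs1.span (set xs))"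
  proof (subst f.inj_on_iff_eq_0[OF vs1.subspace_span], intro ballI impI)
    fix v assume v: "v \<in> vs1.span (set xs)" "f v = 0"
    then have "v \<in> V" using sp vs1.span_mono[of "set xs" "set ks \<union> set xs"] by auto
    then have "v \<in> vs1.span (set ks)" using v ks by (simp add: vs1.basis_list_def)
    then have "vs1.representation (set ks \<union> set xs) v = vs1.representation (set ks) v"
      "vs1.representation (set ks \<union> set xs) v = vs1.representation (set xs) v"
      using v(1) by (auto intro!: vs1.representation_extend[OF indep])
    then have "vs1.representation (set ks \<union> set xs) v b = 0" for b
      using vs1.representation_ne_zero disj by (metis IntI empty_iff)
    then show "v = 0"
      using vs1.sum_nonzero_representation_eq[OF indep, of v] \<open>v \<in> V\<close> sp by simp
  qed
  have ind': "vs1.independent (set xs)" using indep vs1.independent_mono by blast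
  have "vs2.independent (f ` set xs)"
    using f.independent_inj_on_image[OF ind' inj] .
  moreover have "card (f ` set xs) = length xs"
    using inj dist by (metis card_image distinct_card inj_on_subset vs1.span_superset)
  moreover have "vs2.span (f ` set xs) = f ` V"
  proof -
    have "f ` V = vs2.span (f ` set ks \<union> f ` set xs)"
      using f.span_image[of "set ks \<union> set xs"] sp by (simp add: image_Un)
    moreover have "f ` set ks \<subseteq> {0}" using vs1.basis_list_subset[OF ks] by auto
    ultimately show ?thesis
      by (metis (no_types, lifting) subset_singletonD vs2.span_insert_0 insert_is_Un sup_bot_left)
  qed
  ultimately have "vs2.dim (f ` V) = length xs" by (metis vs2.dim_span_eq_card_independent)
  then show ?thesis using vs1.basis_list_length[OF ks] vs1.basis_list_length[OF xs] by simp
qed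

section \<open>Reduction to a smaller pair of spaces\<close>

text \<open>
  The reduction for a map \<open>T\<close> that need not be onto \<open>W\<close>.  The list \<open>es\<close> is a complement of
  \<open>T ` V1\<close> in \<open>T ` V\<close>; it will consist of the ends of chains.  Preimages \<open>us\<close> of \<open>es\<close>
  exist by definition of \<open>T ` V\<close>, and together with \<open>V1\<close> they span \<open>V\<close> up to the kernel of \<open>T\<close>.
  On the other side, \<open>C\<close> is injective from \<open>V\<close> modulo \<open>V1\<close> to \<open>W\<close> modulo \<open>T ` V\<close>, because \<open>V1\<close> is a
  full preimage; so the images of the new basis vectors are independent modulo \<open>T ` V\<close>.
\<close>

lemma preimage_step:
  assumes C: "Vector_Spaces.linear s1 s2 C" and T: "Vector_Spaces.linear s1 s2 T"
    and V: "vs1.fin_dim V" and W: "vs2.fin_dim W"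
    and CW: "C ` V \<subseteq> W" and TW: "T ` V \<subseteq> W"
    and V1: "V1 = {v \<in> V. C v \<in> T ` V}"
    and vs: "vs1.basis_list V1 vs"
    and ws: "vs2.basis_list (T ` V) (es @ os)"
    and os: "vs2.span (T ` set vs) = vs2.span (set os)"
  obtains us ns zs where "map T us = es" "\<forall>u \<in> set ns. T u = 0"
    "vs1.basis_list V (vs @ us @ ns)"
    "vs2.basis_list W (es @ os @ map C us @ map C ns @ zs)"
proof -
  interpret C: Vector_Spaces.linear s1 s2 C by fact
  interpret T: Vector_Spaces.linear s1 s2 T by fact
  interpret self2: subspace_bases_pair s2 s2 ..
  have sV: "vs1.subspace V" using V by (rule vs1.fin_dim_subspace)
  have sW: "vs2.subspace W" using W by (rule vs2.fin_dim_subspace)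
  have sW1: "vs2.subspace (T ` V)" using sV by (rule T.subspace_image)
  have sV1: "vs1.subspace V1"
    using vs1.subspace_inter[OF sV C.subspace_linear_preimage[OF sW1]]
    unfolding V1 by (simp add: Collect_conj_eq)
  have fV1: "vs1.fin_dim V1" using V sV1 by (rule vs1.fin_dim_subset) (auto simp: V1)
  have "set es \<subseteq> T ` V" using vs2.basis_list_subset[OF ws] by simp
  then obtain us where us: "map T us = es" "set us \<subseteq> V"
    using list_preimage by metis
  \<comment> \<open>The vectors \<open>ns\<close> complete \<open>vs @ us\<close>; they are taken as a complement of \<open>ker T\<close> on \<open>V1\<close> in \<open>ker T\<close> on \<open>V\<close>.\<close>
  let ?K = "{v \<in> V. T v = 0}" and ?K1 = "{v \<in> V1. T v = 0}"
  have sK: "vs1.subspace ?K" using T sV by (rule subspace_kernel_on)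
  have sK1: "vs1.subspace ?K1" using T sV1 by (rule subspace_kernel_on)
  have fK: "vs1.fin_dim ?K" using V sK by (rule vs1.fin_dim_subset) auto
  have fK1: "vs1.fin_dim ?K1" using fV1 sK1 by (rule vs1.fin_dim_subset) auto
  obtain ks where ks: "vs1.basis_list ?K1 ks" using fK1 by (rule vs1.basis_list_exists)
  obtain ns where ns: "vs1.basis_list ?K (ks @ ns)"
    by (rule vs1.basis_list_extend[OF ks _ fK]) (auto simp: V1)
  have ns0: "\<forall>u \<in> set ns. T u = 0" "set ns \<subseteq> V"
    using vs1.basis_list_subset[OF ns] by auto
  have TV1: "T ` V1 = vs2.span (set os)"
    using T.span_image[of "set vs"] os vs1.basis_list_span[OF vs] by simp
  have spV: "vs1.span (set (vs @ us @ ns)) = V"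
  proof
    show "vs1.span (set (vs @ us @ ns)) \<subseteq> V"
      using vs1.basis_list_subset[OF vs] us(2) ns0(2) sV
      by (intro vs1.span_minimal) (auto simp: V1)
  next
    let ?S = "vs1.span (set (vs @ us @ ns))"
    have V1S: "V1 \<subseteq> ?S"
      using vs1.basis_list_span[OF vs] vs1.span_mono[of "set vs" "set (vs @ us @ ns)"] by auto
    have "set ks \<subseteq> V1" using vs1.basis_list_subset[OF ks] by auto
    then have "set (ks @ ns) \<subseteq> ?S"
      using V1S vs1.span_superset[of "set (vs @ us @ ns)"] by auto
    then have KS: "?K \<subseteq> ?S"
      using vs1.basis_list_span[OF ns] vs1.span_minimal[OF _ vs1.subspace_span] by blast
    show "V \<subseteq> ?S"
    proof
      fix v assume v: "v \<in> V"
      then have "T v \<in> vs2.span (set es \<union> set os)"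
        using vs2.basis_list_span[OF ws] by auto
      then obtain x y where xy: "T v = x + y" "x \<in> vs2.span (set es)" "y \<in> vs2.span (set os)"
        unfolding vs2.span_Un by auto
      from xy(2) obtain u where u: "u \<in> vs1.span (set us)" "x = T u"
        using T.span_image[of "set us"] us(1) by (metis (no_types, lifting) imageE list.set_map)
      from xy(3) TV1 obtain v1 where v1: "v1 \<in> V1" "y = T v1" by auto
      have "u \<in> V" using u(1) us(2) sV vs1.span_minimal by blast
      have "v - u - v1 \<in> ?K"
        using v \<open>u \<in> V\<close> v1 xy(1) u(2) sV by (auto simp: T.diff V1 intro!: vs1.subspace_diff)
      moreover have "u \<in> ?S" using u(1) vs1.span_mono[of "set us" "set (vs @ us @ ns)"] by auto
      ultimately have "(v - u - v1) + u + v1 \<in> ?S"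
        using KS V1S v1(1) by (intro vs1.span_add) auto
      then show "v \<in> ?S" by simp
    qed
  qed
  have lens: "length us = length es" using us(1) by auto
  have dimW1: "vs2.dim (T ` V) = length es + length os"
    using vs2.basis_list_length[OF ws] by simp
  have "length (vs @ us @ ns) \<le> vs1.dim V"
  proof -
    have "vs1.dim V = vs1.dim ?K + vs2.dim (T ` V)" using T V by (rule rank_nullity)
    moreover have "vs1.dim V1 = vs1.dim ?K1 + vs2.dim (T ` V1)" using T fV1 by (rule rank_nullity)
    moreover have "vs2.dim (T ` V1) \<le> length os" unfolding TV1 by (rule vs2.dim_span_list_le)
    ultimately show ?thesis
      using dimW1 lens vs1.basis_list_length[OF vs] vs1.basis_list_length[OF ks]
        vs1.basis_list_length[OF ns] by simp
  qed
  with spV have bV: "vs1.basis_list V (vs @ us @ ns)" by (rule vs1.basis_listI)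
  let ?ys = "es @ os @ map C us @ map C ns" and ?Y = "vs2.span (set (es @ os @ map C us @ map C ns))"
  have YW: "?Y \<subseteq> W"
    using vs2.basis_list_subset[OF ws] TW CW us(2) ns0(2) sW
    by (intro vs2.span_minimal) (auto simp: image_subset_iff subset_iff)
  obtain p where p: "Vector_Spaces.linear s2 s2 p" "\<And>d. d \<in> T ` V \<Longrightarrow> p d = 0"
    "\<And>w. w \<in> W \<Longrightarrow> p w \<in> W \<and> w - p w \<in> T ` V"
    using vs2.projection_along[OF sW1 sW TW] by blast
  have pker: "p w = 0 \<longleftrightarrow> w \<in> T ` V" if "w \<in> W" for w
    using p(2,3) that by fastforce
  have W1Y: "T ` V \<subseteq> ?Y"
    using vs2.basis_list_span[OF ws] vs2.span_mono[of "set (es @ os)" "set ?ys"] by auto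
  have CY: "C ` V \<subseteq> ?Y"
  proof -
    have "C ` set vs \<subseteq> ?Y" using vs1.basis_list_subset[OF vs] W1Y by (auto simp: V1)
    then have "C ` set (vs @ us @ ns) \<subseteq> ?Y"
      using vs2.span_superset[of "set ?ys"] by auto
    then have "vs2.span (C ` set (vs @ us @ ns)) \<subseteq> ?Y" by (rule vs2.span_minimal) simp
    then show ?thesis using C.span_image spV by metis
  qed
  \<comment> \<open>Rank and nullity of \<open>p \<circ> C\<close> on \<open>V\<close>, with kernel \<open>V1\<close>, and of \<open>p\<close> on \<open>?Y\<close>, with kernel \<open>T ` V\<close>.\<close>
  have "length ?ys \<le> vs2.dim ?Y"
  proof -
    have l: "Vector_Spaces.linear s1 s2 (p \<circ> C)"
      using C p(1) by (rule Vector_Spaces.linear_compose)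
    have "vs1.dim V = vs1.dim {v \<in> V. (p \<circ> C) v = 0} + vs2.dim ((p \<circ> C) ` V)"
      using l V by (rule rank_nullity)
    moreover have "{v \<in> V. (p \<circ> C) v = 0} = V1"
      using pker CW by (auto simp: V1)
    moreover have "vs2.dim ?Y = vs2.dim {w \<in> ?Y. p w = 0} + vs2.dim (p ` ?Y)"
      using p(1) vs2.fin_dim_span by (rule self2.rank_nullity)
    moreover have "{w \<in> ?Y. p w = 0} = T ` V"
      using pker YW W1Y by blast
    moreover have "vs2.dim ((p \<circ> C) ` V) \<le> vs2.dim (p ` ?Y)"
    proof (rule vs2.dim_subspace_le)
      show "vs2.fin_dim (p ` ?Y)" using p(1) vs2.fin_dim_span by (rule self2.fin_dim_image)
      show "vs2.subspace ((p \<circ> C) ` V)"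
        using fin_dim_image[OF l V] by (rule vs2.fin_dim_subspace)
      show "(p \<circ> C) ` V \<subseteq> p ` ?Y" using CY by auto
    qed
    ultimately show ?thesis
      using dimW1 vs1.basis_list_length[OF bV] vs1.basis_list_length[OF vs] by simp
  qed
  then have "vs2.basis_list ?Y ?ys" by (intro vs2.basis_listI) auto
  then obtain zs where "vs2.basis_list W (?ys @ zs)"
    using vs2.basis_list_extend YW W by metis
  then show ?thesis using that us(1) ns0(1) bV by (simp add: append_assoc)
qed

text \<open>
  The reduction for a surjective \<open>B\<close> with kernel \<open>K\<close>.  The subspace \<open>X\<close> is a complement of \<open>K\<close>, and
  \<open>p\<close> divides out \<open>A ` K\<close>, so the pair \<open>p \<circ> A\<close>, \<open>p \<circ> B\<close> on \<open>X\<close> represents the quotient pencil.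
  The vectors \<open>ls\<close>, which will be the ends of the singular chains, are a basis of the kernel of
  \<open>p \<circ> B\<close> on \<open>X\<close>.  Since \<open>B\<close> is an isomorphism from \<open>X\<close> to \<open>W\<close>, their images form a basis of \<open>A ` K\<close>
  by a count of dimensions, and preimages \<open>ks\<close> under \<open>A\<close> of these images prolong the singular
  chains.
\<close>

lemma kernel_step:
  assumes A: "Vector_Spaces.linear s1 s2 A" and B: "Vector_Spaces.linear s1 s2 B"
    and V: "vs1.fin_dim V" and BV: "B ` V = W" and AV: "A ` V \<subseteq> W"
    and K: "K = {v \<in> V. B v = 0}"
    and p: "Vector_Spaces.linear s2 s2 p" "\<And>d. d \<in> A ` K \<Longrightarrow> p d = 0"
    "\<And>w. w \<in> W \<Longrightarrow> p w \<in> W \<and> w - p w \<in> A ` K"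
    and X: "vs1.subspace X" "X \<subseteq> V" "B ` X = W" "\<And>x. x \<in> X \<Longrightarrow> B x = 0 \<Longrightarrow> x = 0"
    and rls: "vs1.basis_list X (rs @ ls)" and ls: "\<forall>l \<in> set ls. p (B l) = 0"
    and ws: "vs2.basis_list (p ` W) (map (p \<circ> B) rs)"
  obtains ks ns where "map A ks = map B ls" "\<forall>n \<in> set ns. A n = 0 \<and> B n = 0"
    "vs1.basis_list K (ks @ ns)" "vs2.basis_list W (map B (rs @ ls))"
proof -
  interpret A: Vector_Spaces.linear s1 s2 A by fact
  interpret B: Vector_Spaces.linear s1 s2 B by fact
  interpret self2: subspace_bases_pair s2 s2 ..
  have sV: "vs1.subspace V" using V by (rule vs1.fin_dim_subspace)
  have sK: "vs1.subspace K" unfolding K using B sV by (rule subspace_kernel_on)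
  have fK: "vs1.fin_dim K" using V sK by (rule vs1.fin_dim_subset) (auto simp: K)
  have fX: "vs1.fin_dim X" using V X(1,2) by (rule vs1.fin_dim_subset)
  have fW: "vs2.fin_dim W" using fin_dim_image[OF B V] BV by simp
  have sW: "vs2.subspace W" using fW by (rule vs2.fin_dim_subspace)
  have sD: "vs2.subspace (A ` K)" using sK by (rule A.subspace_image)
  have fD: "vs2.fin_dim (A ` K)" using A fK by (rule fin_dim_image)
  have DW: "A ` K \<subseteq> W" using AV by (auto simp: K)
  have pker: "p w = 0 \<longleftrightarrow> w \<in> A ` K" if "w \<in> W" for w
    using p(2,3) that by fastforce
  have "{x \<in> X. B x = 0} = {0}" using X(1,4) vs1.subspace_0 B.zero by auto
  then have dX: "vs1.dim X = vs2.dim W"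
    using rank_nullity[OF B fX] X(3) vs1.dim_span_list_le[of "[]"] by simp
  have bW: "vs2.basis_list W (map B (rs @ ls))"
  proof (rule vs2.basis_listI)
    show "vs2.span (set (map B (rs @ ls))) = W"
      using B.span_image[of "set (rs @ ls)"] vs1.basis_list_span[OF rls] X(3)
      by (metis list.set_map)
    show "length (map B (rs @ ls)) \<le> vs2.dim W"
      using vs1.basis_list_length[OF rls] dX by simp
  qed
  have "vs2.dim W = vs2.dim {w \<in> W. p w = 0} + vs2.dim (p ` W)"
    using p(1) fW by (rule self2.rank_nullity)
  moreover have "{w \<in> W. p w = 0} = A ` K" using pker DW by auto
  ultimately have dD: "length ls = vs2.dim (A ` K)"
    using vs2.basis_list_length[OF bW] vs2.basis_list_length[OF ws] by simp
  have bls: "vs2.basis_list (vs2.span (set (map B ls))) (map B ls)"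
    using bW vs2.basis_list_appendD by (metis map_append)
  have "B ` set ls \<subseteq> A ` K"
    using ls pker vs2.basis_list_subset[OF bW] by (auto simp: image_subset_iff)
  then have "vs2.span (set (map B ls)) \<subseteq> A ` K" using sD by (intro vs2.span_minimal) auto
  then have spD: "vs2.span (set (map B ls)) = A ` K"
    using vs2.subspace_eqI_dim[OF fD] vs2.basis_list_length[OF bls] dD by simp
  have "set (map B ls) \<subseteq> A ` K" using \<open>B ` set ls \<subseteq> A ` K\<close> by simp
  then obtain ks where ks: "map A ks = map B ls" "set ks \<subseteq> K"
    using list_preimage by metis
  let ?N = "{v \<in> K. A v = 0}"
  have sN: "vs1.subspace ?N" using A sK by (rule subspace_kernel_on)
  have "vs1.fin_dim ?N" using fK sN by (rule vs1.fin_dim_subset) auto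
  then obtain ns where ns: "vs1.basis_list ?N ns" by (rule vs1.basis_list_exists)
  have "vs1.basis_list K (ks @ ns)"
  proof (rule vs1.basis_listI)
    show "vs1.span (set (ks @ ns)) = K"
    proof
      show "vs1.span (set (ks @ ns)) \<subseteq> K"
        using ks(2) vs1.basis_list_subset[OF ns] sK by (intro vs1.span_minimal) auto
      show "K \<subseteq> vs1.span (set (ks @ ns))"
      proof
        fix v assume v: "v \<in> K"
        then have "A v \<in> A ` vs1.span (set ks)"
          using spD A.span_image[of "set ks"] ks(1) by (metis imageI list.set_map)
        then obtain u where u: "u \<in> vs1.span (set ks)" "A v = A u" by auto
        have "u \<in> K" using u(1) ks(2) sK vs1.span_minimal by blast
        then have "v - u \<in> ?N" using v u(2) sK by (auto simp: A.diff intro: vs1.subspace_diff)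
        then have "v - u \<in> vs1.span (set ns)" using vs1.basis_list_span[OF ns] by simp
        then have "(v - u) + u \<in> vs1.span (set (ks @ ns))"
          using u(1) vs1.span_mono[of "set ks" "set (ks @ ns)"] vs1.span_mono[of "set ns" "set (ks @ ns)"]
          by (intro vs1.span_add) auto
        then show "v \<in> vs1.span (set (ks @ ns))" by simp
      qed
    qed
    have "length ks = length ls" using ks(1) by (metis length_map)
    then show "length (ks @ ns) \<le> vs1.dim K"
      using rank_nullity[OF A fK] dD vs1.basis_list_length[OF ns] by simp
  qed
  moreover have "\<forall>n \<in> set ns. A n = 0 \<and> B n = 0"
    using vs1.basis_list_subset[OF ns] by (auto simp: K)
  ultimately show ?thesis using that ks(1) bW by blast
qed

text \<open>
  A basis of a complement \<open>X\<close> of \<open>K = ker B\<close> may be changed by vectors of \<open>K\<close>, since \<open>V\<close> modulo \<open>K\<close>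
  sees only the values of \<open>B\<close>.
\<close>

lemma basis_list_modify:
  assumes B: "Vector_Spaces.linear s1 s2 B" and V: "vs1.fin_dim V"
    and K: "K = {v \<in> V. B v = 0}"
    and X: "X \<subseteq> V" "B ` X = B ` V" "\<And>x. x \<in> X \<Longrightarrow> B x = 0 \<Longrightarrow> x = 0"
    and xs: "vs1.basis_list X xs" and ks: "vs1.basis_list K ks"
    and ys: "set ys \<subseteq> V" "map B ys = map B xs"
  shows "vs1.basis_list V (ys @ ks)"
proof (rule vs1.basis_listI)
  interpret B: Vector_Spaces.linear s1 s2 B by fact
  have sV: "vs1.subspace V" using V by (rule vs1.fin_dim_subspace)
  have fX: "vs1.fin_dim X" using xs by (rule vs1.basis_list_fin_dim)
  show "vs1.span (set (ys @ ks)) = V"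
  proof
    show "vs1.span (set (ys @ ks)) \<subseteq> V"
      using ys(1) vs1.basis_list_subset[OF ks] sV by (intro vs1.span_minimal) (auto simp: K)
    show "V \<subseteq> vs1.span (set (ys @ ks))"
    proof
      fix v assume v: "v \<in> V"
      have "B ` V = B ` vs1.span (set ys)"
        using X(2) vs1.basis_list_span[OF xs] B.span_image[of "set xs"] B.span_image[of "set ys"] ys(2)
        by (metis list.set_map)
      then obtain u where u: "u \<in> vs1.span (set ys)" "B v = B u" using v by blast
      have "u \<in> V" using u(1) ys(1) sV vs1.span_minimal by blast
      then have "v - u \<in> K" using v u(2) sV by (auto simp: K B.diff intro: vs1.subspace_diff)
      then have "(v - u) + u \<in> vs1.span (set (ys @ ks))"
        using u(1) vs1.basis_list_span[OF ks]
          vs1.span_mono[of "set ys" "set (ys @ ks)"] vs1.span_mono[of "set ks" "set (ys @ ks)"]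
        by (intro vs1.span_add) auto
      then show "v \<in> vs1.span (set (ys @ ks))" by simp
    qed
  qed
  have "{x \<in> X. B x = 0} = {0}"
    using X(3) vs1.subspace_0[OF vs1.fin_dim_subspace[OF fX]] B.zero by auto
  then have "vs1.dim X = vs2.dim (B ` V)"
    using rank_nullity[OF B fX] X(2) vs1.dim_span_list_le[of "[]"] by simp
  moreover have "length ys = length xs" using ys(2) by (metis length_map)
  ultimately show "length (ys @ ks) \<le> vs1.dim V"
    using rank_nullity[OF B V] vs1.basis_list_length[OF xs] vs1.basis_list_length[OF ks]
    by (simp add: K)
qed

end

section \<open>Chains of canonical blocks\<close>

locale pencil_spaces = subspace_bases_pair s1 s2
  for s1 :: "complex \<Rightarrow> 'b::ab_group_add \<Rightarrow> 'b" (infixr \<open>*a\<close> 75)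
  and s2 :: "complex \<Rightarrow> 'c::ab_group_add \<Rightarrow> 'c" (infixr \<open>*b\<close> 75)
begin

text \<open>
  \<open>A\<close> and \<open>B\<close> act on the chain \<open>vs\<close> as the columns of the two matrices of the block prescribe, with
  respect to \<open>ws\<close> (see \<open>chain_represents\<close>).  The list \<open>0 # ws\<close> is \<open>ws\<close> shifted by one place.  In
  this form it is evident how a chain changes when vectors are appended to \<open>vs\<close> and \<open>ws\<close>.
\<close>

fun chain :: "('b \<Rightarrow> 'c) \<Rightarrow> ('b \<Rightarrow> 'c) \<Rightarrow> kblock \<Rightarrow> 'b list \<Rightarrow> 'c list \<Rightarrow> bool" where
  "chain A B (Jordan k (Finite \<mu>)) vs ws \<longleftrightarrow> k \<ge> 1 \<and> length vs = k \<and>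
     map B vs = ws \<and> map (\<lambda>v. A v + \<mu> *b B v) vs = butlast (0 # ws)"
| "chain A B (Jordan k Infinity) vs ws \<longleftrightarrow> k \<ge> 1 \<and> length vs = k \<and>
     map A vs = ws \<and> map B vs = butlast (0 # ws)"
| "chain A B (RSing k) vs ws \<longleftrightarrow> length ws = k \<and> map A vs = 0 # ws \<and> map B vs = ws @ [0]"
| "chain A B (LSing k) vs ws \<longleftrightarrow> length ws = k + 1 \<and> length vs = k \<and>
     map A vs = tl ws \<and> map B vs = butlast ws"

definition domain_list :: "(kblock \<times> 'b list \<times> 'c list) list \<Rightarrow> 'b list" where
  "domain_list items = concat (map (\<lambda>(b, vs, ws). vs) items)"

definition codomain_list :: "(kblock \<times> 'b list \<times> 'c list) list \<Rightarrow> 'c list" where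
  "codomain_list items = concat (map (\<lambda>(b, vs, ws). ws) items)"

lemma domain_list_simps [simp]:
  "domain_list [] = []" "domain_list ((b, vs, ws) # items) = vs @ domain_list items"
  "domain_list (xs @ ys) = domain_list xs @ domain_list ys"
  by (auto simp: domain_list_def)

lemma codomain_list_simps [simp]:
  "codomain_list [] = []" "codomain_list ((b, vs, ws) # items) = ws @ codomain_list items"
  "codomain_list (xs @ ys) = codomain_list xs @ codomain_list ys"
  by (auto simp: codomain_list_def)

definition decomposes ::
  "('b \<Rightarrow> 'c) \<Rightarrow> ('b \<Rightarrow> 'c) \<Rightarrow> 'b set \<Rightarrow> 'c set \<Rightarrow> (kblock \<times> 'b list \<times> 'c list) list \<Rightarrow> bool"
where
  "decomposes A B V W items \<longleftrightarrow> (\<forall>(b, vs, ws) \<in> set items. chain A B b vs ws) \<and>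
     vs1.basis_list V (domain_list items) \<and> vs2.basis_list W (codomain_list items)"

lemma span_image_Union_eq:
  assumes "\<And>x. x \<in> I \<Longrightarrow> vs2.span (f x) = vs2.span (g x)"
  shows "vs2.span (\<Union>x\<in>I. f x) = vs2.span (\<Union>x\<in>I. g x)"
  unfolding vs2.span_eq using assms
  by (auto simp: subset_iff)
     (metis UN_upper subsetD vs2.span_base vs2.span_mono)+

text \<open>
  \<open>preimage_step\<close> in terms of chains, for an arbitrary pair \<open>C\<close>, \<open>T\<close> in place of \<open>A\<close>, \<open>B\<close>.  The
  predicate \<open>P\<close> marks the blocks whose chains miss their last vector in the image of \<open>T\<close>; they are
  prolonged, and \<open>g\<close> is the effect on the block.  The block \<open>b0\<close> is started by vectors of \<open>ker T\<close>.
  The dimensions in the second conclusion tell when no zero row is split off.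
\<close>

lemma extend_decomposition:
  assumes C: "Vector_Spaces.linear s1 s2 C" and T: "Vector_Spaces.linear s1 s2 T"
    and V: "vs1.fin_dim V" and W: "vs2.fin_dim W"
    and CW: "C ` V \<subseteq> W" and TW: "T ` V \<subseteq> W"
    and V1: "V1 = {v \<in> V. C v \<in> T ` V}"
    and dec: "decomposes A B V1 (T ` V) items"
    and grow: "\<And>b vs ws. (b, vs, ws) \<in> set items \<Longrightarrow> P b \<Longrightarrow>
        ws \<noteq> [] \<and> vs2.span (T ` set vs) = vs2.span (set (butlast ws)) \<and>
        (\<forall>u. T u = last ws \<longrightarrow> chain A B (g b) (vs @ [u]) (ws @ [C u]))"
    and nogrow: "\<And>b vs ws. (b, vs, ws) \<in> set items \<Longrightarrow> \<not> P b \<Longrightarrow>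
        vs2.span (T ` set vs) = vs2.span (set ws)"
    and new: "\<And>u. T u = 0 \<Longrightarrow> chain A B b0 [u] [C u]"
  obtains items' where "decomposes A B V W items'"
    "\<And>b vs ws. (b, vs, ws) \<in> set items' \<Longrightarrow>
       (\<exists>b'\<in>fst ` set items. b = b' \<or> b = g b' \<and> P b') \<or> b = b0 \<or>
       b = LSing 0 \<and> vs1.dim V1 + vs2.dim W \<noteq> vs1.dim V + vs2.dim (T ` V)"
proof -
  define G where "G = filter (\<lambda>(b, vs, ws). P b) items"
  define R where "R = filter (\<lambda>(b, vs, ws). \<not> P b) items"
  define es where "es = map (\<lambda>(b, vs, ws). last ws) G"
  define rest where "rest = (\<lambda>(b, vs :: 'b list, ws :: 'c list). if P b then butlast ws else ws)"
  define os where "os = concat (map rest items)"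
  have bV1: "vs1.basis_list V1 (domain_list items)"
    and bW1: "vs2.basis_list (T ` V) (codomain_list items)"
    and ch: "\<And>b vs ws. (b, vs, ws) \<in> set items \<Longrightarrow> chain A B b vs ws"
    using dec by (auto simp: decomposes_def)
  have mdom: "mset (domain_list G) + mset (domain_list R) = mset (domain_list items)"
    unfolding G_def R_def by (induction items) auto
  have mcod: "mset (codomain_list G) + mset (codomain_list R) = mset (codomain_list items)"
    unfolding G_def R_def by (induction items) auto
  have grow_ne: "\<forall>(b, vs, ws) \<in> set items. P b \<longrightarrow> ws \<noteq> []" using grow by auto
  then have meo: "mset (es @ os) = mset (codomain_list items)"
    unfolding es_def os_def G_def rest_def
  proof (induction items)
    case (Cons it items)
    obtain b vs ws where it: "it = (b, vs, ws)" by (cases it)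
    have "P b \<Longrightarrow> ws = butlast ws @ [last ws]"
      using Cons.prems it by simp
    then have "P b \<Longrightarrow> mset ws = add_mset (last ws) (mset (butlast ws))"
      by (metis add_mset_add_single mset_append mset.simps(1,2) add.left_neutral)
    then show ?case using Cons it by auto
  qed simp
  then have bes: "vs2.basis_list (T ` V) (es @ os)"
    using vs2.basis_list_mset[OF bW1] by simp
  have "vs2.span ((\<lambda>(b, vs, ws). T ` set vs) it) = vs2.span (set (rest it))"
    if "it \<in> set items" for it
    using grow nogrow that by (cases it) (auto simp: rest_def)
  then have "vs2.span (\<Union>(b, vs, ws)\<in>set items. T ` set vs)
      = vs2.span (\<Union>it\<in>set items. set (rest it))"
    by (rule span_image_Union_eq)
  moreover have "(\<Union>(b, vs, ws)\<in>set items. T ` set vs) = T ` set (domain_list items)"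
    by (simp add: domain_list_def image_UN case_prod_beta)
  ultimately have spos: "vs2.span (T ` set (domain_list items)) = vs2.span (set os)"
    by (simp add: os_def)
  obtain us ns zs where us: "map T us = es" and ns: "\<forall>u \<in> set ns. T u = 0"
    and bV: "vs1.basis_list V (domain_list items @ us @ ns)"
    and bW: "vs2.basis_list W (es @ os @ map C us @ map C ns @ zs)"
    using preimage_step[OF C T V W CW TW V1 bV1 bes spos] by metis
  define G' where "G' = map (\<lambda>((b, vs, ws), u). (g b, vs @ [u], ws @ [C u])) (zip G us)"
  define items' where "items' = G' @ R @ map (\<lambda>u. (b0, [u], [C u])) ns @ map (\<lambda>z. (LSing 0, [], [z])) zs"
  have len: "length G = length us" using us by (metis es_def length_map)
  have dG': "mset (domain_list G') = mset (domain_list G) + mset us"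
    using len unfolding G'_def by (induction G us rule: list_induct2) auto
  have cG': "mset (codomain_list G') = mset (codomain_list G) + mset (map C us)"
    using len unfolding G'_def by (induction G us rule: list_induct2) auto
  have nd: "domain_list (map (\<lambda>u. (b0, [u], [C u])) ns) = ns"
    "codomain_list (map (\<lambda>u. (b0, [u], [C u])) ns) = map C ns" for ns
    by (induction ns) auto
  have zd: "domain_list (map (\<lambda>z. (LSing 0, [], [z])) zs) = []"
    "codomain_list (map (\<lambda>z. (LSing 0, [], [z])) zs) = zs" for zs
    by (induction zs) auto
  have "mset (domain_list items') = mset (domain_list items @ us @ ns)"
    unfolding items'_def by (simp add: nd zd dG' mdom[symmetric])
  then have bV': "vs1.basis_list V (domain_list items')"
    using vs1.basis_list_mset[OF bV] by simp
  have "mset (codomain_list items') = mset (es @ os @ map C us @ map C ns @ zs)"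
    unfolding items'_def using meo mcod by (simp add: nd zd cG' add_ac)
  then have bW': "vs2.basis_list W (codomain_list items')"
    using vs2.basis_list_mset[OF bW] by simp
  have chG: "chain A B b vs ws \<and> (\<exists>b'\<in>fst ` set items. b = g b' \<and> P b')"
    if bvw: "(b, vs, ws) \<in> set G'" for b vs ws
  proof -
    from bvw obtain i b' vs' ws' where i: "i < length G" "G ! i = (b', vs', ws')"
      "b = g b'" "vs = vs' @ [us ! i]" "ws = ws' @ [C (us ! i)]"
      using len by (auto simp: G'_def in_set_conv_nth split: prod.splits)
    have "map T us ! i = es ! i" using us by simp
    then have "T (us ! i) = last ws'" using i len by (simp add: es_def)
    moreover have "(b', vs', ws') \<in> set G" using i by (metis nth_mem)
    then have "(b', vs', ws') \<in> set items" "P b'" by (auto simp: G_def)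
    ultimately show ?thesis using grow[of b' vs' ws'] i by force
  qed
  show ?thesis
  proof (rule that[of items'])
    show "decomposes A B V W items'"
      unfolding decomposes_def using bV' bW' chG ch new ns
      by (auto simp: items'_def R_def)
    fix b vs ws assume "(b, vs, ws) \<in> set items'"
    then consider "(b, vs, ws) \<in> set G'" | "(b, vs, ws) \<in> set R" | "b = b0"
      | "b = LSing 0" "zs \<noteq> []"
      unfolding items'_def by (cases zs) auto
    then show "(\<exists>b'\<in>fst ` set items. b = b' \<or> b = g b' \<and> P b') \<or> b = b0 \<or>
       b = LSing 0 \<and> vs1.dim V1 + vs2.dim W \<noteq> vs1.dim V + vs2.dim (T ` V)"
    proof cases
      case 1
      then show ?thesis using chG by blast
    next
      case 2
      then show ?thesis by (force simp: R_def)
    next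
      case 4
      have "length es = length us" using us by auto
      moreover have "length zs > 0" using 4 by simp
      ultimately have "vs1.dim V1 + vs2.dim W \<noteq> vs1.dim V + vs2.dim (T ` V)"
        using vs1.basis_list_length[OF bV] vs2.basis_list_length[OF bW]
          vs1.basis_list_length[OF bV1] vs2.basis_list_length[OF bes]
        by (simp del: length_greater_0_conv)
      then show ?thesis using 4 by simp
    qed simp
  qed
qed

section \<open>Kronecker's theorem for pairs of linear maps\<close>

lemma linear_pencil_value:
  assumes "Vector_Spaces.linear s1 s2 A" "Vector_Spaces.linear s1 s2 B"
  shows "Vector_Spaces.linear s1 s2 (\<lambda>v. A v + \<mu> *b B v)"
  by (intro linear_compose_add linear_compose_scale_right assms)

text \<open>
  As \<open>B\<close> maps the basis \<open>vs\<close> of \<open>V\<close> to a basis of \<open>W\<close>, the map \<open>A\<close> becomes a square complex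
  matrix, whose characteristic polynomial has a root.
\<close>

lemma eigenvector_exists:
  assumes A: "Vector_Spaces.linear s1 s2 A" and B: "Vector_Spaces.linear s1 s2 B"
    and vs: "vs1.basis_list V vs" "vs \<noteq> []"
    and ws: "vs2.basis_list W (map B vs)" and AV: "A ` V \<subseteq> W"
  obtains \<mu> v where "v \<in> V" "v \<noteq> 0" "A v + \<mu> *b B v = 0"
proof -
  interpret A: Vector_Spaces.linear s1 s2 A by fact
  interpret B: Vector_Spaces.linear s1 s2 B by fact
  let ?n = "length vs"
  have "\<exists>c. A (vs ! j) = (\<Sum>i<?n. c i *b B (vs ! i))" if "j < ?n" for j
  proof -
    have "A (vs ! j) \<in> vs2.span (set (map B vs))"
      using that AV vs1.basis_list_subset[OF vs(1)] vs2.basis_list_span[OF ws] nth_mem by blast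
    then show ?thesis using vs2.span_list[of "A (vs ! j)" "map B vs"] by simp
  qed
  then obtain c where c: "\<And>j. j < ?n \<Longrightarrow> A (vs ! j) = (\<Sum>i<?n. c j i *b B (vs ! i))"
    by metis
  define M where "M = mat ?n ?n (\<lambda>(i, j). c j i)"
  have M: "M \<in> carrier_mat ?n ?n" by (simp add: M_def)
  have "degree (char_poly M) \<noteq> 0" using degree_monic_char_poly[OF M] vs(2) by simp
  then have "\<not> constant (poly (char_poly M))" by (simp add: constant_degree)
  then obtain z where "poly (char_poly M) z = 0" using fundamental_theorem_of_algebra by blast
  then have "eigenvalue M z" using eigenvalue_root_char_poly[OF M] by simp
  then obtain x where x: "x \<in> carrier_vec ?n" "x \<noteq> 0\<^sub>v ?n" "M *\<^sub>v x = z \<cdot>\<^sub>v x"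
    using M by (auto simp: eigenvalue_def eigenvector_def)
  define v where "v = (\<Sum>j<?n. (x $ j) *a (vs ! j))"
  have "v \<in> V" using vs1.sum_in_span_list[of "\<lambda>j. x $ j" vs] vs1.basis_list_span[OF vs(1)]
    by (simp add: v_def)
  moreover have "v \<noteq> 0"
  proof
    assume "v = 0"
    then have "x $ j = 0" if "j < ?n" for j
      using vs1.basis_list_sum_eq_0[OF vs(1), of "\<lambda>j. x $ j"] that by (simp add: v_def)
    then have "x = 0\<^sub>v ?n" using x(1) by (intro eq_vecI) auto
    then show False using x(2) by simp
  qed
  moreover have "A v = z *b B v"
  proof -
    have Mx: "(\<Sum>j<?n. x $ j * c j i) = z * x $ i" if "i < ?n" for i
    proof -
      have "(M *\<^sub>v x) $ i = (z \<cdot>\<^sub>v x) $ i" using x(3) by simp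
      then show ?thesis using that x(1)
        by (simp add: M_def scalar_prod_def atLeast0LessThan mult.commute)
    qed
    have "A v = (\<Sum>j<?n. (x $ j) *b (\<Sum>i<?n. c j i *b B (vs ! i)))"
      by (simp add: v_def A.sum A.scale c)
    also have "\<dots> = (\<Sum>j<?n. \<Sum>i<?n. (x $ j * c j i) *b B (vs ! i))"
      by (simp add: vs2.scale_sum_right)
    also have "\<dots> = (\<Sum>i<?n. \<Sum>j<?n. (x $ j * c j i) *b B (vs ! i))"
      by (rule sum.swap)
    also have "\<dots> = (\<Sum>i<?n. (z * x $ i) *b B (vs ! i))"
      by (intro sum.cong refl) (simp add: vs2.scale_sum_left[symmetric] Mx)
    also have "\<dots> = z *b B v"
      by (simp add: v_def B.sum B.scale vs2.scale_sum_right)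
    finally show ?thesis .
  qed
  then have "A v + (- z) *b B v = 0" by simp
  ultimately show ?thesis using that by blast
qed

lemma butlast_Cons: "ws \<noteq> [] \<Longrightarrow> butlast (x # ws) = x # butlast ws"
  by simp

lemma span_shifted_chain:
  assumes "map T vs = butlast (0 # ws)" "ws \<noteq> []"
  shows "vs2.span (T ` set vs) = vs2.span (set (butlast ws))"
proof -
  have "T ` set vs = set (0 # butlast ws)" using assms by (metis list.set_map butlast_Cons)
  then show ?thesis by simp
qed

lemma extend_shifted_chain:
  assumes "map T vs = butlast (0 # ws)" "T u = last ws" "ws \<noteq> []"
  shows "map T (vs @ [u]) = butlast (0 # ws @ [w])"
  using assms by (simp add: butlast_append)

text \<open>
  On a Jordan chain for \<open>\<nu>\<close> the map \<open>A + \<mu> B\<close> is triangular with diagonal entries \<open>\<mu> - \<nu>\<close>, so it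
  is onto the span of the chain.
\<close>

lemma span_other_eigenvalue:
  assumes "map B vs = ws" "map (\<lambda>v. A v + \<nu> *b B v) vs = butlast (0 # ws)" "\<nu> \<noteq> \<mu>"
  shows "vs2.span ((\<lambda>v. A v + \<mu> *b B v) ` set vs) = vs2.span (set ws)"
proof -
  let ?T = "\<lambda>v. A v + \<mu> *b B v"
  define prev where "prev j = (if j = 0 then 0 else ws ! (j - 1))" for j
  have len: "length ws = length vs" using assms(1) by auto
  have T: "?T (vs ! j) = prev j + (\<mu> - \<nu>) *b (ws ! j)" if "j < length vs" for j
  proof -
    have "map (\<lambda>v. A v + \<nu> *b B v) vs ! j = butlast (0 # ws) ! j" using assms(2) by simp
    then have "A (vs ! j) + \<nu> *b B (vs ! j) = prev j"
      using that len by (cases "ws = []") (auto simp: nth_butlast prev_def nth_Cons')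
    moreover have "B (vs ! j) = ws ! j" using assms(1) that by auto
    ultimately show ?thesis by (simp add: algebra_simps vs2.scale_left_diff_distrib)
  qed
  have prev: "prev j \<in> vs2.span (set ws)" if "j < length vs" for j
    using that len by (auto simp: prev_def vs2.span_zero intro: vs2.span_base)
  then have "?T (vs ! j) \<in> vs2.span (set ws)" if "j < length vs" for j
    unfolding T[OF that] using that len
    by (intro vs2.span_add vs2.span_scale vs2.span_base[OF nth_mem] prev) auto
  then have "?T ` set vs \<subseteq> vs2.span (set ws)" by (auto simp: in_set_conv_nth)
  moreover have "ws ! j \<in> vs2.span (?T ` set vs)" if "j < length ws" for j
    using that
  proof (induction j)
    case 0
    then have "ws ! 0 = (1 / (\<mu> - \<nu>)) *b ?T (vs ! 0)"
      using T[of 0] len assms(3) by (simp add: prev_def)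
    moreover have "?T (vs ! 0) \<in> vs2.span (?T ` set vs)"
      using 0 len by (intro vs2.span_base imageI) auto
    ultimately show ?case by (metis vs2.span_scale)
  next
    case (Suc j)
    then have "ws ! Suc j = (1 / (\<mu> - \<nu>)) *b (?T (vs ! Suc j) - ws ! j)"
      using T[of "Suc j"] len assms(3) by (simp add: prev_def)
    moreover have "?T (vs ! Suc j) \<in> vs2.span (?T ` set vs)"
      using Suc len by (intro vs2.span_base imageI) auto
    ultimately show ?case
      using Suc by (metis Suc_lessD vs2.span_diff vs2.span_scale)
  qed
  then have "set ws \<subseteq> vs2.span (?T ` set vs)" by (auto simp: in_set_conv_nth)
  ultimately show ?thesis by (simp add: vs2.span_eq)
qed

lemma dim_zero_trivial:
  assumes "vs1.fin_dim V" "vs1.dim V = 0" shows "V = {0}" "vs1.basis_list V []"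
proof -
  obtain xs where "vs1.basis_list V xs" using assms(1) vs1.basis_list_exists by blast
  then show b: "vs1.basis_list V []" using vs1.basis_list_length assms(2) by fastforce
  show "V = {0}" using vs1.basis_list_span[OF b] by simp
qed

fun lengthen :: "kblock \<Rightarrow> kblock" where
  "lengthen (Jordan k \<mu>) = Jordan (k + 1) \<mu>"
| "lengthen (LSing k) = LSing (k + 1)"
| "lengthen (RSing k) = RSing (k + 1)"

text \<open>
  Jordan's theorem.  Some \<open>T = A + \<mu> B\<close> has a kernel, hence is not onto, and the induction hypothesis
  applies to \<open>V1 = {v \<in> V. B v \<in> T ` V}\<close>.  The chains for \<open>\<mu>\<close> are prolonged by the pair \<open>(B, T)\<close>;
  those for other eigenvalues stay.
\<close>

lemma decomposition_bijective:
  assumes "Vector_Spaces.linear s1 s2 A" "Vector_Spaces.linear s1 s2 B"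
    and "vs1.fin_dim V" "B ` V = W" "A ` V \<subseteq> W" "vs1.dim V = vs2.dim W"
  shows "\<exists>items. decomposes A B V W items \<and>
    (\<forall>(b, vs, ws) \<in> set items. \<exists>k \<mu>. b = Jordan k (Finite \<mu>))"
  using assms
proof (induction "vs1.dim V" arbitrary: V W rule: less_induct)
  case less
  note A = less.prems(1) and B = less.prems(2) and V = less.prems(3) and BV = less.prems(4)
    and AV = less.prems(5) and dimeq = less.prems(6)
  interpret A: Vector_Spaces.linear s1 s2 A by fact
  interpret B: Vector_Spaces.linear s1 s2 B by fact
  have sV: "vs1.subspace V" using V by (rule vs1.fin_dim_subspace)
  have W: "vs2.fin_dim W" using fin_dim_image[OF B V] BV by simp
  have sW: "vs2.subspace W" using W by (rule vs2.fin_dim_subspace)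
  have kerB: "vs1.dim {v \<in> V. B v = 0} = 0" using rank_nullity[OF B V] BV dimeq by simp
  obtain vs where vs: "vs1.basis_list V vs" using V vs1.basis_list_exists by blast
  have ws: "vs2.basis_list W (map B vs)"
  proof (rule vs2.basis_listI)
    show "vs2.span (set (map B vs)) = W"
      using B.span_image[of "set vs"] vs1.basis_list_span[OF vs] BV by simp
    show "length (map B vs) \<le> vs2.dim W" using vs1.basis_list_length[OF vs] dimeq by simp
  qed
  show ?case
  proof (cases "vs = []")
    case True
    then show ?thesis using vs ws by (intro exI[of _ "[]"]) (simp add: decomposes_def)
  next
    case False
    obtain \<mu> v where v: "v \<in> V" "v \<noteq> 0" "A v + \<mu> *b B v = 0"
      using eigenvector_exists[OF A B vs False ws AV] by blast
    define T where "T v = A v + \<mu> *b B v" for v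
    have T: "Vector_Spaces.linear s1 s2 T"
      using linear_pencil_value[OF A B, of \<mu>] unfolding T_def[abs_def] .
    interpret T: Vector_Spaces.linear s1 s2 T by fact
    have TW: "T ` V \<subseteq> W" using AV BV sW by (auto simp: T_def intro!: vs2.subspace_add vs2.subspace_scale)
    have sTV: "vs2.subspace (T ` V)" using sV by (rule T.subspace_image)
    have "vs1.fin_dim {v \<in> V. T v = 0}"
      using V subspace_kernel_on[OF T sV] by (rule vs1.fin_dim_subset) auto
    then have "vs1.dim {v \<in> V. T v = 0} \<noteq> 0"
      using dim_zero_trivial(1) v by (auto simp: T_def)
    then have dT: "vs2.dim (T ` V) < vs1.dim V" using rank_nullity[OF T V] by simp
    define V1 where "V1 = {v \<in> V. B v \<in> T ` V}"
    have sV1: "vs1.subspace V1"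
      using vs1.subspace_inter[OF sV B.subspace_linear_preimage[OF sTV]]
      unfolding V1_def by (simp add: Collect_conj_eq)
    have fV1: "vs1.fin_dim V1" using V sV1 by (rule vs1.fin_dim_subset) (auto simp: V1_def)
    have BV1: "B ` V1 = T ` V"
    proof
      show "T ` V \<subseteq> B ` V1"
      proof
        fix y assume y: "y \<in> T ` V"
        then obtain x where "x \<in> V" "y = B x" using TW BV by blast
        then show "y \<in> B ` V1" using y by (auto simp: V1_def)
      qed
    qed (auto simp: V1_def)
    have "{v \<in> V1. B v = 0} \<subseteq> {v \<in> V. B v = 0}" by (auto simp: V1_def)
    moreover have "vs1.subspace {v \<in> V1. B v = 0}" using B sV1 by (rule subspace_kernel_on)
    moreover have "vs1.fin_dim {v \<in> V. B v = 0}"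
      using V subspace_kernel_on[OF B sV] by (rule vs1.fin_dim_subset) auto
    ultimately have "vs1.dim {v \<in> V1. B v = 0} = 0"
      using vs1.dim_subspace_le kerB by fastforce
    then have dV1: "vs1.dim V1 = vs2.dim (T ` V)" using rank_nullity[OF B fV1] BV1 by simp
    have AV1: "A ` V1 \<subseteq> T ` V"
    proof
      fix y assume "y \<in> A ` V1"
      then obtain x where x: "x \<in> V" "B x \<in> T ` V" "y = A x" by (auto simp: V1_def)
      then have "T x - \<mu> *b B x \<in> T ` V"
        using sTV by (intro vs2.subspace_diff vs2.subspace_scale) auto
      then show "y \<in> T ` V" using x by (simp add: T_def)
    qed
    obtain items where items: "decomposes A B V1 (T ` V) items"
      "\<forall>(b, vs, ws) \<in> set items. \<exists>k \<mu>. b = Jordan k (Finite \<mu>)"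
      using less.hyps[of V1 "T ` V"] dT dV1 A B fV1 BV1 AV1 by auto
    have ch: "\<And>b vs ws. (b, vs, ws) \<in> set items \<Longrightarrow> chain A B b vs ws"
      using items(1) by (auto simp: decomposes_def)
    let ?P = "\<lambda>b. \<exists>k. b = Jordan k (Finite \<mu>)"
    obtain items' where items': "decomposes A B V W items'"
      "\<And>b vs ws. (b, vs, ws) \<in> set items' \<Longrightarrow>
       (\<exists>b'\<in>fst ` set items. b = b' \<or> b = lengthen b' \<and> ?P b') \<or> b = Jordan 1 (Finite \<mu>) \<or>
       b = LSing 0 \<and> vs1.dim V1 + vs2.dim W \<noteq> vs1.dim V + vs2.dim (T ` V)"
    proof (rule extend_decomposition[OF B T V W _ TW V1_def items(1),
          where P = ?P and g = lengthen and ?b0.0 = "Jordan 1 (Finite \<mu>)"])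
      show "B ` V \<subseteq> W" using BV by simp
    next
      fix b vs ws assume bvw: "(b, vs, ws) \<in> set items" "?P b"
      then obtain k where "b = Jordan k (Finite \<mu>)" by blast
      then show "ws \<noteq> [] \<and> vs2.span (T ` set vs) = vs2.span (set (butlast ws)) \<and>
        (\<forall>u. T u = last ws \<longrightarrow> chain A B (lengthen b) (vs @ [u]) (ws @ [B u]))"
        using ch[OF bvw(1)] span_shifted_chain[of T vs ws] extend_shifted_chain[of T vs ws]
        by (auto simp: T_def[abs_def])
    next
      fix b vs ws assume bvw: "(b, vs, ws) \<in> set items" "\<not> ?P b"
      then obtain k \<nu> where "b = Jordan k (Finite \<nu>)" "\<nu> \<noteq> \<mu>" using items(2) by blast
      then show "vs2.span (T ` set vs) = vs2.span (set ws)"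
        using ch[OF bvw(1)] span_other_eigenvalue[of B vs ws A \<nu> \<mu>] unfolding T_def[abs_def] by simp
    qed (auto simp: T_def that)
    have "\<exists>k \<mu>. b = Jordan k (Finite \<mu>)" if "(b, vs, ws) \<in> set items'" for b vs ws
      using items'(2)[OF that] items(2) dV1 dimeq by (auto simp: case_prod_beta)
    then show ?thesis using items'(1) by blast
  qed
qed

text \<open>
  Equations that hold modulo \<open>C ` K\<close> become exact after a change of the vectors by elements of
  \<open>K = ker B\<close>, and this change does not affect the values of \<open>B\<close>.
\<close>

lemma modify_by_kernel:
  assumes C: "Vector_Spaces.linear s1 s2 C" and B: "Vector_Spaces.linear s1 s2 B"
    and p: "Vector_Spaces.linear s2 s2 p"
    and sV: "vs1.subspace V" and sW: "vs2.subspace W"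
    and K: "K = {v \<in> V. B v = 0}" and CV: "C ` V \<subseteq> W"
    and pker: "\<And>w. w \<in> W \<Longrightarrow> p w = 0 \<Longrightarrow> w \<in> C ` K"
    and vs: "set vs \<subseteq> V" and ys: "set ys \<subseteq> W"
    and eq: "map (\<lambda>v. p (C v)) vs = map p ys"
  shows "\<exists>us. set us \<subseteq> V \<and> map B us = map B vs \<and> map C us = ys"
proof -
  interpret C: Vector_Spaces.linear s1 s2 C by fact
  interpret B: Vector_Spaces.linear s1 s2 B by fact
  interpret p: Vector_Spaces.linear s2 s2 p by fact
  have "length vs = length ys" using eq by (metis length_map)
  then show ?thesis using vs ys eq
  proof (induction vs ys rule: list_induct2)
    case (Cons v vs y ys)
    then obtain us where us: "set us \<subseteq> V" "map B us = map B vs" "map C us = ys" by auto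
    have "C v \<in> W" "y \<in> W" using Cons.prems CV by auto
    then have "C v - y \<in> C ` K"
      using Cons.prems sW by (intro pker vs2.subspace_diff) (auto simp: p.diff)
    then obtain k where k: "k \<in> V" "B k = 0" "C v - y = C k" by (auto simp: K)
    have "v - k \<in> V" using k Cons.prems sV by (auto intro: vs1.subspace_diff)
    moreover have "C (v - k) = y" using k(3)[symmetric] by (simp add: C.diff)
    ultimately show ?case
      using us k by (intro exI[of _ "(v - k) # us"]) (simp add: B.diff)
  qed simp
qed

text \<open>
  The chains of the quotient by \<open>K = ker B\<close> and \<open>A ` K\<close> are lifted as follows.  In \<open>W\<close> the lifted
  chain is simply \<open>map B vs\<close>; this makes the equations for \<open>B\<close> true by definition.  Those for \<open>A\<close>
  hold modulo \<open>A ` K\<close> and are repaired by \<open>modify_by_kernel\<close>.  For a singular chain, \<open>map B vs\<close> has one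
  vector more than the chain of the quotient had, and \<open>kernel_step\<close> provides the vector that
  closes it.
\<close>

lemma decomposition_surjective:
  assumes "Vector_Spaces.linear s1 s2 A" "Vector_Spaces.linear s1 s2 B"
    and "vs1.fin_dim V" "B ` V = W" "A ` V \<subseteq> W"
  shows "\<exists>items. decomposes A B V W items \<and>
    (\<forall>(b, vs, ws) \<in> set items. (\<exists>k \<mu>. b = Jordan k (Finite \<mu>)) \<or> (\<exists>k. b = RSing k))"
  using assms
proof (induction "vs1.dim V" arbitrary: A B V W rule: less_induct)
  case less
  note A = less.prems(1) and B = less.prems(2) and V = less.prems(3) and BV = less.prems(4)
    and AV = less.prems(5)
  interpret A: Vector_Spaces.linear s1 s2 A by fact
  interpret B: Vector_Spaces.linear s1 s2 B by fact
  interpret self1: subspace_bases_pair s1 s1 ..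
  have sV: "vs1.subspace V" using V by (rule vs1.fin_dim_subspace)
  have fW: "vs2.fin_dim W" using fin_dim_image[OF B V] BV by simp
  have sW: "vs2.subspace W" using fW by (rule vs2.fin_dim_subspace)
  define K where "K = {v \<in> V. B v = 0}"
  have sK: "vs1.subspace K" unfolding K_def using B sV by (rule subspace_kernel_on)
  have fK: "vs1.fin_dim K" using V sK by (rule vs1.fin_dim_subset) (auto simp: K_def)
  have KV: "K \<subseteq> V" by (auto simp: K_def)
  have dimV: "vs1.dim V = vs1.dim K + vs2.dim W"
    using rank_nullity[OF B V] BV by (simp add: K_def)
  show ?case
  proof (cases "vs1.dim K = 0")
    case True
    then have "vs1.dim V = vs2.dim W" using dimV by simp
    then show ?thesis using decomposition_bijective[OF A B V BV AV] by fast
  next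
    case False
    have sD: "vs2.subspace (A ` K)" using sK by (rule A.subspace_image)
    have DW: "A ` K \<subseteq> W" using AV KV by auto
    obtain p where p: "Vector_Spaces.linear s2 s2 p" "\<And>d. d \<in> A ` K \<Longrightarrow> p d = 0"
      "\<And>w. w \<in> W \<Longrightarrow> p w \<in> W \<and> w - p w \<in> A ` K"
      using vs2.projection_along[OF sD sW DW] by blast
    interpret p: Vector_Spaces.linear s2 s2 p by fact
    have pker: "w \<in> A ` K" if "w \<in> W" "p w = 0" for w
      using p(3) that by fastforce
    obtain q where q: "Vector_Spaces.linear s1 s1 q" "\<And>d. d \<in> K \<Longrightarrow> q d = 0"
      "\<And>v. v \<in> V \<Longrightarrow> q v \<in> V \<and> v - q v \<in> K"
      using vs1.projection_along[OF sK sV KV] by blast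
    interpret q: Vector_Spaces.linear s1 s1 q by fact
    define X where "X = q ` V"
    have sX: "vs1.subspace X" unfolding X_def using sV by (rule q.subspace_image)
    have XV: "X \<subseteq> V" using q(3) by (auto simp: X_def)
    have fX: "vs1.fin_dim X" using V sX XV by (rule vs1.fin_dim_subset)
    have Bq: "B (q v) = B v" if "v \<in> V" for v
      using q(3)[OF that] by (simp add: K_def B.diff)
    have BX: "B ` X = W" using Bq BV by (auto simp: X_def image_image)
    have X0: "x = 0" if "x \<in> X" "B x = 0" for x
    proof -
      obtain v where v: "v \<in> V" "x = q v" using \<open>x \<in> X\<close> by (auto simp: X_def)
      then have "v \<in> K" using that Bq by (simp add: K_def)
      then show ?thesis using q(2) v by simp
    qed
    have "{x \<in> X. B x = 0} = {0}" using X0 vs1.subspace_0[OF sX] B.zero by auto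
    then have "vs1.dim X = vs2.dim W"
      using rank_nullity[OF B fX] BX vs1.dim_span_list_le[of "[]"] by simp
    then have dX: "vs1.dim X < vs1.dim V" using dimV False by simp
    define A' where "A' v = p (A v)" for v
    define B' where "B' v = p (B v)" for v
    have A': "Vector_Spaces.linear s1 s2 A'"
      using Vector_Spaces.linear_compose[OF A p(1)] by (simp add: A'_def[abs_def] comp_def)
    have B': "Vector_Spaces.linear s1 s2 B'"
      using Vector_Spaces.linear_compose[OF B p(1)] by (simp add: B'_def[abs_def] comp_def)
    have BX': "B' ` X = p ` W" unfolding BX[symmetric] by (simp add: B'_def[abs_def] image_image)
    have AX': "A' ` X \<subseteq> p ` W" using AV XV by (auto simp: A'_def)
    obtain items where items: "decomposes A' B' X (p ` W) items"
      "\<forall>(b, vs, ws) \<in> set items. (\<exists>k \<mu>. b = Jordan k (Finite \<mu>)) \<or> (\<exists>k. b = RSing k)"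
      using less.hyps[OF dX A' B' fX BX' AX'] by blast
    have ch: "\<And>b vs ws. (b, vs, ws) \<in> set items \<Longrightarrow> chain A' B' b vs ws"
      and bX: "vs1.basis_list X (domain_list items)"
      and bW': "vs2.basis_list (p ` W) (codomain_list items)"
      using items(1) by (auto simp: decomposes_def)
    define sing where "sing = (\<lambda>(b, vs :: 'b list, ws :: 'c list). \<exists>k. b = RSing k)"
    \<comment> \<open>\<open>G\<close>: the singular chains, with ends \<open>ls\<close>; \<open>J\<close>: the Jordan chains.\<close>
    define G where "G = filter sing items"
    define J where "J = filter (\<lambda>it. \<not> sing it) items"
    define ls where "ls = map (\<lambda>(b, vs, ws). last vs) G"
    define rest where "rest = (\<lambda>(b, vs :: 'b list, ws :: 'c list). if (\<exists>k. b = RSing k) then butlast vs else vs)"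
    define rs where "rs = concat (map rest items)"
    have in_V: "set vs \<subseteq> V" if "(b, vs, ws) \<in> set items" for b vs ws
      using that vs1.basis_list_subset[OF bX] XV by (force simp: domain_list_def)
    have RS: "vs = butlast vs @ [last vs] \<and> B' (last vs) = 0 \<and> map B' (butlast vs) = ws \<and> ws = butlast (map B' vs)"
      if "(RSing k, vs, ws) \<in> set items" for k vs ws
    proof -
      have c: "map A' vs = 0 # ws" "map B' vs = ws @ [0]" using ch[OF that] by auto
      then have "vs \<noteq> []" by auto
      then have "vs = butlast vs @ [last vs]" by simp
      then have "map B' (butlast vs) @ [B' (last vs)] = ws @ [0]"
        using c(2) by (metis map_append list.map(1,2))
      then show ?thesis using c \<open>vs \<noteq> []\<close> by simp
    qed
    have mrl: "mset (rs @ ls) = mset (domain_list items)"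
    proof -
      have "\<forall>(b, vs, ws) \<in> set items. \<forall>k. b = RSing k \<longrightarrow> vs = butlast vs @ [last vs]"
        using RS by auto
      then show ?thesis unfolding rs_def ls_def G_def rest_def sing_def
      proof (induction items)
        case (Cons it items)
        obtain b vs ws where it: "it = (b, vs, ws)" by (cases it)
        have "b = RSing k \<Longrightarrow> vs = butlast vs @ [last vs]" for k
          using Cons.prems it by simp
        then have "b = RSing k \<Longrightarrow> mset vs = add_mset (last vs) (mset (butlast vs))" for k
          by (metis add_mset_add_single mset_append mset.simps(1,2) add.left_neutral)
        then show ?case using Cons it by (auto split: if_splits)
      qed simp
    qed
    have brl: "vs1.basis_list X (rs @ ls)" using vs1.basis_list_mset[OF bX] mrl by simp
    have "\<forall>(b, vs, ws) \<in> set items. map B' (rest (b, vs, ws)) = ws"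
      using items(2) ch RS by (fastforce simp: rest_def)
    then have "map B' rs = codomain_list items"
      unfolding rs_def codomain_list_def by (induction items) auto
    then have bprs: "vs2.basis_list (p ` W) (map (p \<circ> B) rs)"
      using bW' by (simp add: B'_def[abs_def] comp_def)
    have ls0: "\<forall>l \<in> set ls. p (B l) = 0"
      using RS by (auto simp: ls_def G_def sing_def B'_def)
    obtain ks ns where ks: "map A ks = map B ls" and ns: "\<forall>n \<in> set ns. A n = 0 \<and> B n = 0"
      and bK: "vs1.basis_list K (ks @ ns)" and bW: "vs2.basis_list W (map B (rs @ ls))"
      using kernel_step[OF A B V BV AV K_def p sX XV BX X0 brl ls0 bprs] by metis
    have kK: "set ks \<subseteq> K" using vs1.basis_list_subset[OF bK] by simp
    define lifted where "lifted b vs us \<longleftrightarrow> set us \<subseteq> V \<and> map B us = map B vs \<and>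
        (case b of Jordan k (Finite \<mu>) \<Rightarrow> map (\<lambda>v. A v + \<mu> *b B v) us = butlast (0 # map B vs)
         | RSing k \<Rightarrow> map A us = 0 # butlast (map B vs) | _ \<Rightarrow> True)" for b vs us
    have lift: "\<exists>us. lifted b vs us"
      if bvw: "(b, vs, ws) \<in> set items" for b vs ws
    proof -
      have vsV: "set vs \<subseteq> V" using in_V bvw by simp
      have BW: "set (map B vs) \<subseteq> W" using vsV BV by auto
      have BW': "set (butlast (map B vs)) \<subseteq> W"
        using BW by (meson in_set_butlastD subset_iff)
      have W0: "0 \<in> W" using sW by (rule vs2.subspace_0)
      consider k \<mu> where "b = Jordan k (Finite \<mu>)" | k where "b = RSing k"
        using items(2) bvw by fast
      then show ?thesis
      proof cases
        case (1 k \<mu>)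
        define C where "C v = A v + \<mu> *b B v" for v
        have C: "Vector_Spaces.linear s1 s2 C"
          using linear_pencil_value[OF A B, of \<mu>] unfolding C_def[abs_def] .
        have "C ` K = A ` K" by (rule image_cong) (auto simp: C_def K_def)
        moreover have "C ` V \<subseteq> W"
          using AV BV sW by (auto simp: C_def intro!: vs2.subspace_add vs2.subspace_scale)
        moreover have "set (butlast (0 # map B vs)) \<subseteq> W"
          using BW' W0 by auto
        moreover have "map (\<lambda>v. p (C v)) vs = map p (butlast (0 # map B vs))"
        proof -
          have "map (\<lambda>v. p (C v)) vs = map (\<lambda>v. A' v + \<mu> *b B' v) vs"
            by (simp add: C_def A'_def B'_def p.add p.scale)
          also have "\<dots> = butlast (0 # map B' vs)" using ch[OF bvw] 1 by auto
          also have "\<dots> = map p (butlast (0 # map B vs))"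
            by (simp add: map_butlast B'_def[abs_def] comp_def)
          finally show ?thesis .
        qed
        ultimately have "\<exists>us. set us \<subseteq> V \<and> map B us = map B vs \<and> map C us = butlast (0 # map B vs)"
          using pker vsV by (intro modify_by_kernel[OF C B p(1) sV sW K_def]) auto
        then show ?thesis using 1 by (simp add: C_def[abs_def] lifted_def)
      next
        case (2 k)
        have "map (\<lambda>v. p (A v)) vs = map p (0 # butlast (map B vs))"
          using ch[OF bvw] RS[of k vs ws] bvw 2
          by (simp add: map_butlast A'_def[abs_def] B'_def[abs_def] comp_def)
        moreover have "set (0 # butlast (map B vs)) \<subseteq> W"
          using BW' W0 by auto
        ultimately have "\<exists>us. set us \<subseteq> V \<and> map B us = map B vs \<and> map A us = 0 # butlast (map B vs)"
          using pker vsV AV by (intro modify_by_kernel[OF A B p(1) sV sW K_def]) auto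
        then show ?thesis using 2 by (simp add: lifted_def)
      qed
    qed
    have "\<exists>us. lifted (fst it) (fst (snd it)) us" if "it \<in> set items" for it
      using lift[of "fst it" "fst (snd it)" "snd (snd it)"] that by simp
    then obtain f where f: "\<And>it. it \<in> set items \<Longrightarrow> lifted (fst it) (fst (snd it)) (f it)"
      by metis
    define G' where "G' = map (\<lambda>((b, vs, ws), k). (lengthen b, f (b, vs, ws) @ [k], map B vs)) (zip G ks)"
    define J' where "J' = map (\<lambda>(b, vs, ws). (b, f (b, vs, ws), map B vs)) J"
    define N' where "N' = map (\<lambda>n. (RSing 0, [n], [] :: 'c list)) ns"
    have len: "length G = length ks" using ks by (metis length_map ls_def)
    have bV: "vs1.basis_list V (concat (map f items) @ (ks @ ns))"
    proof (rule basis_list_modify[OF B V K_def XV _ X0 bX bK])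
      show "B ` X = B ` V" using BX BV by simp
      show "set (concat (map f items)) \<subseteq> V" using f by (auto simp: lifted_def)
      show "map B (concat (map f items)) = map B (domain_list items)"
        using f unfolding domain_list_def by (induction items) (auto simp: case_prod_beta lifted_def)
    qed
    have "mset (domain_list G') = mset (concat (map f G)) + mset ks"
      using len unfolding G'_def by (induction G ks rule: list_induct2) auto
    moreover have "mset (domain_list J') = mset (concat (map f J))"
      unfolding J'_def by (induction J) auto
    moreover have "mset (concat (map f G)) + mset (concat (map f J)) = mset (concat (map f items))"
      unfolding G_def J_def by (induction items) auto
    moreover have "domain_list N' = ns" unfolding N'_def by (induction ns) auto
    ultimately have "mset (domain_list (G' @ J' @ N')) = mset (concat (map f items) @ (ks @ ns))"
      by (simp add: add_ac)
    then have bV': "vs1.basis_list V (domain_list (G' @ J' @ N'))"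
      using vs1.basis_list_mset[OF bV] by simp
    have "mset (codomain_list G') = image_mset B (mset (domain_list G))"
      using len unfolding G'_def by (induction G ks rule: list_induct2) auto
    moreover have "mset (codomain_list J') = image_mset B (mset (domain_list J))"
      unfolding J'_def by (induction J) auto
    moreover have "mset (domain_list G) + mset (domain_list J) = mset (domain_list items)"
      unfolding G_def J_def by (induction items) auto
    moreover have "codomain_list N' = []" unfolding N'_def by (induction ns) auto
    ultimately have "mset (codomain_list (G' @ J' @ N')) = mset (map B (rs @ ls))"
      using mrl by (simp flip: image_mset_union)
    then have bW'': "vs2.basis_list W (codomain_list (G' @ J' @ N'))"
      using vs2.basis_list_mset[OF bW] by simp
    have chG: "chain A B b vs ws \<and> (\<exists>k. b = RSing k)" if bvw: "(b, vs, ws) \<in> set G'" for b vs ws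
    proof -
      from bvw obtain i b' vs' ws' where i: "i < length G" "G ! i = (b', vs', ws')"
        "b = lengthen b'" "vs = f (b', vs', ws') @ [ks ! i]" "ws = map B vs'"
        using len by (auto simp: G'_def in_set_conv_nth split: prod.splits)
      have "(b', vs', ws') \<in> set G" using i by (metis nth_mem)
      then obtain k where k: "b' = RSing k" "(RSing k, vs', ws') \<in> set items"
        by (auto simp: G_def sing_def)
      have "map A ks ! i = map B ls ! i" using ks by simp
      then have Ak: "A (ks ! i) = B (last vs')" using i len by (simp add: ls_def)
      have "ks ! i \<in> K" using kK i len by (metis nth_mem subsetD)
      then have Bk: "B (ks ! i) = 0" by (simp add: K_def)
      have "length ws' = k" using ch[OF k(2)] by simp
      moreover have vs': "vs' = butlast vs' @ [last vs']" "map B' (butlast vs') = ws'"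
        using RS[OF k(2)] by auto
      ultimately have "length vs' = k + 1"
        by (metis length_append length_map list.size(3,4) add_0 One_nat_def)
      moreover have "map B vs' = butlast (map B vs') @ [B (last vs')]"
        using vs'(1) by (metis last_map map_is_Nil_conv append_butlast_last_id snoc_eq_iff_butlast)
      ultimately show ?thesis using f[OF k(2)] i k(1) Ak Bk by (simp add: lifted_def)
    qed
    have chJ: "chain A B b vs ws \<and> (\<exists>k \<mu>. b = Jordan k (Finite \<mu>))"
      if bvw: "(b, vs, ws) \<in> set J'" for b vs ws
    proof -
      from bvw obtain vs' ws' where J: "(b, vs', ws') \<in> set items" "\<not> (\<exists>k. b = RSing k)"
        "vs = f (b, vs', ws')" "ws = map B vs'"
        by (auto simp: J'_def J_def sing_def)
      then obtain k \<mu> where b: "b = Jordan k (Finite \<mu>)" using items(2) by fast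
      have "length vs = length vs'" using f[OF J(1)] J(3) unfolding lifted_def by (metis length_map fst_conv snd_conv)
      then show ?thesis using f[OF J(1)] J b ch[OF J(1)] by (simp add: lifted_def)
    qed
    have "decomposes A B V W (G' @ J' @ N')"
      unfolding decomposes_def using bV' bW'' chG chJ ns by (auto simp: N'_def)
    moreover have "\<forall>(b, vs, ws) \<in> set (G' @ J' @ N').
        (\<exists>k \<mu>. b = Jordan k (Finite \<mu>)) \<or> (\<exists>k. b = RSing k)"
      using chG chJ by (auto simp: N'_def)
    ultimately show ?thesis by blast
  qed
qed

text \<open>
  Induction on \<open>dim W\<close>.  When \<open>B\<close> is not onto, exactly the chains of types \<open>J(\<infinity>)\<close> and \<open>L\<^sup>T\<close> are
  prolonged.
\<close>

theorem kronecker_decomposition: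
  assumes "Vector_Spaces.linear s1 s2 A" "Vector_Spaces.linear s1 s2 B"
    and "vs1.fin_dim V" "vs2.fin_dim W" "A ` V \<subseteq> W" "B ` V \<subseteq> W"
  shows "\<exists>items. decomposes A B V W items"
  using assms
proof (induction "vs2.dim W" arbitrary: V W rule: less_induct)
  case less
  note A = less.prems(1) and B = less.prems(2) and V = less.prems(3) and W = less.prems(4)
    and AV = less.prems(5) and BV = less.prems(6)
  interpret A: Vector_Spaces.linear s1 s2 A by fact
  interpret B: Vector_Spaces.linear s1 s2 B by fact
  have sV: "vs1.subspace V" using V by (rule vs1.fin_dim_subspace)
  have sBV: "vs2.subspace (B ` V)" using sV by (rule B.subspace_image)
  have fBV: "vs2.fin_dim (B ` V)" using B V by (rule fin_dim_image)
  show ?case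
  proof (cases "B ` V = W")
    case True
    then show ?thesis using decomposition_surjective[OF A B V True AV] by blast
  next
    case False
    then have dim: "vs2.dim (B ` V) < vs2.dim W"
      using vs2.subspace_eqI_dim[OF W sBV BV] by linarith
    define V1 where "V1 = {v \<in> V. A v \<in> B ` V}"
    have sV1: "vs1.subspace V1"
      using vs1.subspace_inter[OF sV A.subspace_linear_preimage[OF sBV]]
      unfolding V1_def by (simp add: Collect_conj_eq)
    have fV1: "vs1.fin_dim V1" using V sV1 by (rule vs1.fin_dim_subset) (auto simp: V1_def)
    obtain items where items: "decomposes A B V1 (B ` V) items"
      using less.hyps[OF dim A B fV1 fBV] by (auto simp: V1_def)
    have ch: "\<And>b vs ws. (b, vs, ws) \<in> set items \<Longrightarrow> chain A B b vs ws"
      using items(1) by (auto simp: decomposes_def)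
    let ?P = "\<lambda>b. (\<exists>k. b = Jordan k Infinity) \<or> (\<exists>k. b = LSing k)"
    show ?thesis
    proof (rule extend_decomposition[OF A B V W AV BV V1_def items,
          where P = ?P and g = lengthen and ?b0.0 = "Jordan 1 Infinity"])
      fix b vs ws assume bvw: "(b, vs, ws) \<in> set items" "?P b"
      then consider k where "b = Jordan k Infinity" | k where "b = LSing k" by blast
      then show "ws \<noteq> [] \<and> vs2.span (B ` set vs) = vs2.span (set (butlast ws)) \<and>
        (\<forall>u. B u = last ws \<longrightarrow> chain A B (lengthen b) (vs @ [u]) (ws @ [A u]))"
      proof cases
        case 1
        then show ?thesis
          using ch[OF bvw(1)] span_shifted_chain[of B vs ws] extend_shifted_chain[of B vs ws]
          by auto
      next
        case 2
        then have c: "map A vs = tl ws" "map B vs = butlast ws" "length ws = k + 1" "length vs = k"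
          using ch[OF bvw(1)] by auto
        then have "ws \<noteq> []" by auto
        moreover have "B ` set vs = set (butlast ws)" using c by (metis list.set_map)
        ultimately show ?thesis using 2 c by (auto simp: tl_append split: list.split)
      qed
    next
      fix b vs ws assume bvw: "(b, vs, ws) \<in> set items" "\<not> ?P b"
      then consider k \<mu> where "b = Jordan k (Finite \<mu>)" | k where "b = RSing k"
        by (metis ecomplex.exhaust kblock.exhaust)
      then show "vs2.span (B ` set vs) = vs2.span (set ws)"
      proof cases
        case 1
        then have "B ` set vs = set ws" using ch[OF bvw(1)] by auto
        then show ?thesis by simp
      next
        case 2
        then have "B ` set vs = set (ws @ [0])" using ch[OF bvw(1)] by (metis list.set_map chain.simps(3))
        then show ?thesis by simp
      qed
    qed auto
  qed
qed

end

section \<open>Kronecker's theorem for matrix pencils\<close>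

context subspace_bases_pair
begin

definition represents :: "('b \<Rightarrow> 'c) \<Rightarrow> 'a mat \<Rightarrow> 'b list \<Rightarrow> 'c list \<Rightarrow> bool" where
  "represents f X vs ws \<longleftrightarrow> X \<in> carrier_mat (length ws) (length vs) \<and>
     (\<forall>j<length vs. f (vs ! j) = (\<Sum>i<length ws. (X $$ (i, j)) *b (ws ! i)))"

lemma represents_block_diagonal:
  assumes X: "represents f X vs ws" and Y: "represents f Y vs' ws'"
  shows "represents f (four_block_mat X (0\<^sub>m (dim_row X) (dim_col Y)) (0\<^sub>m (dim_row Y) (dim_col X)) Y)
    (vs @ vs') (ws @ ws')"
proof -
  let ?Z = "four_block_mat X (0\<^sub>m (dim_row X) (dim_col Y)) (0\<^sub>m (dim_row Y) (dim_col X)) Y"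
  have dims: "dim_row X = length ws" "dim_col X = length vs" "dim_row Y = length ws'" "dim_col Y = length vs'"
    using X Y by (auto simp: represents_def)
  have split: "(\<Sum>i<length ws + length ws'. g i) = (\<Sum>i<length ws. g i) + (\<Sum>i<length ws'. g (length ws + i))"
    for g :: "nat \<Rightarrow> 'c"
    using sum.atLeastLessThan_concat[of 0 "length ws" "length ws + length ws'" g]
      sum.shift_bounds_nat_ivl[of g 0 "length ws" "length ws'"]
    by (simp add: atLeast0LessThan add.commute)
  have Z: "?Z $$ (i, j) = (if i < length ws then if j < length vs then X $$ (i, j) else 0
      else if j < length vs then 0 else Y $$ (i - length ws, j - length vs))"
    if "i < length ws + length ws'" "j < length vs + length vs'" for i j
    using that dims by (subst index_mat_four_block) auto
  have "f ((vs @ vs') ! j) = (\<Sum>i<length (ws @ ws'). (?Z $$ (i, j)) *b ((ws @ ws') ! i))"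
    if j: "j < length (vs @ vs')" for j
  proof (cases "j < length vs")
    case True
    have "(\<Sum>i<length ws. (?Z $$ (i, j)) *b ((ws @ ws') ! i)) = (\<Sum>i<length ws. (X $$ (i, j)) *b (ws ! i))"
      using True by (intro sum.cong) (simp_all add: Z nth_append)
    moreover have "(\<Sum>i<length ws'. (?Z $$ (length ws + i, j)) *b ((ws @ ws') ! (length ws + i))) = 0"
      using True by (intro sum.neutral) (simp add: Z)
    ultimately show ?thesis
      using X True by (simp only: length_append split) (simp add: nth_append represents_def)
  next
    case False
    then have j': "j - length vs < length vs'" using j by auto
    have "(\<Sum>i<length ws'. (?Z $$ (length ws + i, j)) *b ((ws @ ws') ! (length ws + i))) =
        (\<Sum>i<length ws'. (Y $$ (i, j - length vs)) *b (ws' ! i))"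
      using False j by (intro sum.cong) (simp_all add: Z)
    moreover have "(\<Sum>i<length ws. (?Z $$ (i, j)) *b ((ws @ ws') ! i)) = 0"
      using False j by (intro sum.neutral) (simp add: Z)
    ultimately show ?thesis
      using Y False j' by (simp only: length_append split) (simp add: nth_append represents_def)
  qed
  moreover have "?Z \<in> carrier_mat (length (ws @ ws')) (length (vs @ vs'))"
    using four_block_carrier_mat[of X "length ws" "length vs" Y "length ws'" "length vs'"] dims
    by (metis carrier_mat_triv length_append)
  ultimately show ?thesis by (simp add: represents_def)
qed

end

context pencil_spaces
begin

lemma sum_if_eq_index:
  "(\<Sum>i<length ws. (if i = k then c else 0) *b (ws ! i)) = (if k < length ws then c *b (ws ! k) else 0)"
proof -
  have "(\<Sum>i<length ws. (if i = k then c else 0) *b (ws ! i)) = (\<Sum>i<length ws. if i = k then c *b (ws ! k) else 0)"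
    by (intro sum.cong) auto
  then show ?thesis by (simp add: sum.delta)
qed

lemma bidiagonal_sum:
  assumes "\<And>i. i < length ws \<Longrightarrow> X $$ (i, j) = (if i = j then c else if Suc i = j then d else 0)"
  shows "(\<Sum>i<length ws. (X $$ (i, j)) *b (ws ! i)) =
    (if j < length ws then c *b (ws ! j) else 0) +
    (if 0 < j \<and> j - 1 < length ws then d *b (ws ! (j - 1)) else 0)"
proof -
  have "(\<Sum>i<length ws. (X $$ (i, j)) *b (ws ! i)) =
    (\<Sum>i<length ws. (if i = j then c else 0) *b (ws ! i)) +
    (\<Sum>i<length ws. (if i = j - 1 then (if 0 < j then d else 0) else 0) *b (ws ! i))"
    unfolding sum.distrib[symmetric] using assms by (intro sum.cong) auto
  then show ?thesis unfolding sum_if_eq_index by auto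
qed

lemma nth_shifted: "j < length ws \<Longrightarrow> butlast (0 # ws) ! j = (if 0 < j then ws ! (j - 1) else 0)"
  by (cases ws rule: rev_cases) (auto simp: nth_append nth_Cons' butlast_append)

lemma chain_represents:
  assumes "chain A B b vs ws"
  shows "represents A (fst (block_pencil b)) vs ws" "represents B (snd (block_pencil b)) vs ws"
proof -
  have "represents A (fst (block_pencil b)) vs ws \<and> represents B (snd (block_pencil b)) vs ws"
  proof (cases b)
    case (Jordan k \<mu>)
    show ?thesis
    proof (cases \<mu>)
      case (Finite z)
      have c: "length vs = k" "length ws = k" "map B vs = ws"
        "map (\<lambda>v. A v + z *b B v) vs = butlast (0 # ws)"
        using assms Jordan Finite by auto
      have B: "B (vs ! j) = ws ! j" if "j < k" for j using c(1,3) that nth_map by metis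
      have "A (vs ! j) + z *b B (vs ! j) = (if 0 < j then ws ! (j - 1) else 0)" if "j < k" for j
        using nth_map[of j vs "\<lambda>v. A v + z *b B v"] c nth_shifted[of j ws] that by simp
      then have A: "A (vs ! j) = (- z) *b (ws ! j) + (if 0 < j then ws ! (j - 1) else 0)" if "j < k" for j
        using that B by (simp add: algebra_simps)
      have "A (vs ! j) = (\<Sum>i<length ws. (fst (block_pencil b) $$ (i, j)) *b (ws ! i))" if "j < k" for j
        using A[OF that] that c(1,2) Jordan Finite
        by (subst bidiagonal_sum[where c = "- z" and d = 1]) (auto simp: jordan_block_def)
      moreover have "B (vs ! j) = (\<Sum>i<length ws. (snd (block_pencil b) $$ (i, j)) *b (ws ! i))" if "j < k" for j
        using B[OF that] that c(1,2) Jordan Finite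
        by (subst bidiagonal_sum[where c = 1 and d = 0]) auto
      ultimately show ?thesis
        using c(1,2) Jordan Finite unfolding represents_def by (auto simp: jordan_block_def)
    next
      case Infinity
      have c: "length vs = k" "length ws = k" "map A vs = ws" "map B vs = butlast (0 # ws)"
        using assms Jordan Infinity by auto
      have A: "A (vs ! j) = ws ! j" if "j < k" for j using c(1,3) that nth_map by metis
      have B: "B (vs ! j) = (if 0 < j then ws ! (j - 1) else 0)" if "j < k" for j
        using nth_map[of j vs B] c nth_shifted[of j ws] that by simp
      have "A (vs ! j) = (\<Sum>i<length ws. (fst (block_pencil b) $$ (i, j)) *b (ws ! i))" if "j < k" for j
        using A[OF that] that c(1,2) Jordan Infinity
        by (subst bidiagonal_sum[where c = 1 and d = 0]) auto
      moreover have "B (vs ! j) = (\<Sum>i<length ws. (snd (block_pencil b) $$ (i, j)) *b (ws ! i))" if "j < k" for j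
        using B[OF that] that c(1,2) Jordan Infinity
        by (subst bidiagonal_sum[where c = 0 and d = 1]) (auto simp: jordan_block_def)
      ultimately show ?thesis
        using c(1,2) Jordan Infinity unfolding represents_def by (auto simp: jordan_block_def)
    qed
  next
    case (RSing k)
    have c: "length ws = k" "map A vs = 0 # ws" "map B vs = ws @ [0]" using assms RSing by auto
    then have l: "length vs = k + 1" by (metis length_map length_Cons Suc_eq_plus1)
    have A: "A (vs ! j) = (if 0 < j then ws ! (j - 1) else 0)" if "j < k + 1" for j
      using nth_map[of j vs A] c l that by (cases "j = 0") (auto simp: nth_Cons')
    have B: "B (vs ! j) = (if j < k then ws ! j else 0)" if "j < k + 1" for j
      using nth_map[of j vs B] c l that by (cases "j < k") (auto simp: nth_append)
    have "A (vs ! j) = (\<Sum>i<length ws. (fst (block_pencil b) $$ (i, j)) *b (ws ! i))" if "j < k + 1" for j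
    proof -
      have "j - 1 < k" if "0 < j" using that \<open>j < k + 1\<close> by simp
      then show ?thesis using A[OF that] that c(1) RSing
        by (subst bidiagonal_sum[where c = 0 and d = 1]) auto
    qed
    moreover have "B (vs ! j) = (\<Sum>i<length ws. (snd (block_pencil b) $$ (i, j)) *b (ws ! i))" if "j < k + 1" for j
      using B[OF that] that c(1) RSing
      by (subst bidiagonal_sum[where c = 1 and d = 0]) auto
    ultimately show ?thesis using c(1) l RSing unfolding represents_def by simp
  next
    case (LSing k)
    have c: "length ws = k + 1" "length vs = k" "map A vs = tl ws" "map B vs = butlast ws"
      using assms LSing by auto
    have A: "A (vs ! j) = ws ! (j + 1)" if "j < k" for j
      using nth_map[of j vs A] c that by (simp add: nth_tl)
    have B: "B (vs ! j) = ws ! j" if "j < k" for j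
      using nth_map[of j vs B] c that by (simp add: nth_butlast)
    have "A (vs ! j) = (\<Sum>i<length ws. (fst (block_pencil b) $$ (i, j)) *b (ws ! i))" if "j < k" for j
    proof -
      have "(\<Sum>i<length ws. (fst (block_pencil b) $$ (i, j)) *b (ws ! i)) =
          (\<Sum>i<length ws. (if i = j + 1 then 1 else 0) *b (ws ! i))"
        using c(1,2) that LSing by (intro sum.cong) auto
      then show ?thesis using A[OF that] that c(1,2) unfolding sum_if_eq_index by simp
    qed
    moreover have "B (vs ! j) = (\<Sum>i<length ws. (snd (block_pencil b) $$ (i, j)) *b (ws ! i))" if "j < k" for j
      using B[OF that] that c(1,2) LSing
      by (subst bidiagonal_sum[where c = 1 and d = 0]) auto
    ultimately show ?thesis using c(1,2) LSing unfolding represents_def by simp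
  qed
  then show "represents A (fst (block_pencil b)) vs ws" "represents B (snd (block_pencil b)) vs ws"
    by auto
qed

end

text \<open>
  Vectors are infinite sequences, so that \<open>\<complex>\<^sup>n\<close> for all \<open>n\<close> is found in one type as a space of
  sequences that vanish from index \<open>n\<close> on.
\<close>

definition cscale :: "complex \<Rightarrow> (nat \<Rightarrow> complex) \<Rightarrow> nat \<Rightarrow> complex" where
  "cscale c f = (\<lambda>i. c * f i)"

interpretation coords: pencil_spaces cscale cscale
  by unfold_locales (auto simp: cscale_def fun_eq_iff algebra_simps)

definition first_coords :: "nat \<Rightarrow> (nat \<Rightarrow> complex) set" where
  "first_coords n = {f. \<forall>i\<ge>n. f i = 0}"

lemma fun_sum_apply: "(\<Sum>x\<in>S. f x) i = (\<Sum>x\<in>S. f x i :: complex)"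
  by (induction S rule: infinite_finite_induct) auto

definition unit_fun :: "nat \<Rightarrow> nat \<Rightarrow> complex" where
  "unit_fun i = (\<lambda>j. if j = i then 1 else 0)"

lemma unit_fun_basis: "coords.vs1.basis_list (first_coords n) (map unit_fun [0..<n])"
proof -
  have inj: "inj_on unit_fun S" for S
    by (rule inj_onI) (metis unit_fun_def zero_neq_one)
  have set: "set (map unit_fun [0..<n]) = unit_fun ` {..<n}" by (auto simp: atLeast0LessThan)
  have "coords.vs1.independent (unit_fun ` {..<n})"
  proof (rule coords.vs1.independent_if_scalars_zero)
    fix u x assume u: "(\<Sum>x\<in>unit_fun ` {..<n}. cscale (u x) x) = 0" and x: "x \<in> unit_fun ` {..<n}"
    then obtain i where i: "i < n" "x = unit_fun i" by auto
    have "0 = (\<Sum>k<n. cscale (u (unit_fun k)) (unit_fun k)) i"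
      using u by (simp add: sum.reindex[OF inj] comp_def)
    also have "\<dots> = u x" using i
      by (simp add: fun_sum_apply cscale_def unit_fun_def if_distrib[of "\<lambda>t. _ * t"] sum.delta cong: if_cong)
    finally show "u x = 0" by simp
  qed simp
  moreover have "coords.vs1.span (unit_fun ` {..<n}) = first_coords n"
  proof (rule coords.vs1.span_subspace)
    show "unit_fun ` {..<n} \<subseteq> first_coords n" by (auto simp: unit_fun_def first_coords_def)
    show "coords.vs1.subspace (first_coords n)"
      by (auto simp: coords.vs1.subspace_def first_coords_def cscale_def)
    show "first_coords n \<subseteq> coords.vs1.span (unit_fun ` {..<n})"
    proof
      fix f assume f: "f \<in> first_coords n"
      have "f = (\<Sum>i<n. cscale (f i) (unit_fun i))"
        using f by (auto simp: fun_eq_iff fun_sum_apply cscale_def unit_fun_def first_coords_def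
            if_distrib[of "\<lambda>t. _ * t"] sum.delta' cong: if_cong)
      also have "\<dots> \<in> coords.vs1.span (unit_fun ` {..<n})"
        by (intro coords.vs1.span_sum coords.vs1.span_scale coords.vs1.span_base) auto
      finally show "f \<in> coords.vs1.span (unit_fun ` {..<n})" .
    qed
  qed
  ultimately show ?thesis
    unfolding coords.vs1.basis_list_def set by (simp add: distinct_map inj)
qed

definition mat_fun :: "complex mat \<Rightarrow> (nat \<Rightarrow> complex) \<Rightarrow> nat \<Rightarrow> complex" where
  "mat_fun A f = (\<lambda>i. if i < dim_row A then \<Sum>j<dim_col A. A $$ (i, j) * f j else 0)"

lemma linear_mat_fun: "Vector_Spaces.linear cscale cscale (mat_fun A)"
  unfolding Vector_Spaces.linear_iff
  by (auto simp: coords.vs1.vector_space_axioms mat_fun_def fun_eq_iff cscale_def sum.distrib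
      algebra_simps sum_distrib_left)

lemma basis_matrix_inverse:
  assumes "coords.vs1.basis_list (first_coords n) vs"
  obtains R where "R \<in> carrier_mat n n"
    "mat n n (\<lambda>(i, j). (vs ! j) i) * R = 1\<^sub>m n" "R * mat n n (\<lambda>(i, j). (vs ! j) i) = 1\<^sub>m n"
proof -
  let ?Q = "mat n n (\<lambda>(i, j). (vs ! j) i)"
  have len: "length vs = n"
    using coords.vs1.basis_list_length[OF assms] coords.vs1.basis_list_length[OF unit_fun_basis[of n]]
    by simp
  have "\<exists>c. unit_fun i = (\<Sum>j<n. cscale (c j) (vs ! j))" if "i < n" for i
  proof -
    have "unit_fun i \<in> coords.vs1.span (set vs)"
      using that coords.vs1.basis_list_span[OF assms] by (auto simp: first_coords_def unit_fun_def)
    then show ?thesis using coords.vs1.span_list len by metis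
  qed
  then obtain c where c: "\<And>i. i < n \<Longrightarrow> unit_fun i = (\<Sum>j<n. cscale (c i j) (vs ! j))" by metis
  define R where "R = mat n n (\<lambda>(j, i). c i j)"
  have R: "R \<in> carrier_mat n n" by (simp add: R_def)
  have "?Q * R = 1\<^sub>m n"
  proof (rule eq_matI)
    fix i k assume ik: "i < dim_row (1\<^sub>m n)" "k < dim_col (1\<^sub>m n)"
    have "unit_fun k i = (\<Sum>j<n. c k j * (vs ! j) i)"
      using c[of k] ik by (simp add: fun_sum_apply cscale_def)
    then show "(?Q * R) $$ (i, k) = 1\<^sub>m n $$ (i, k)"
      using ik by (auto simp: R_def scalar_prod_def atLeast0LessThan mult.commute unit_fun_def)
  qed (auto simp: R_def)
  then show ?thesis using that[OF R] mat_mult_left_right_inverse[OF _ R] by simp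
qed

lemma invertible_matI:
  assumes "P \<in> carrier_mat n n" "R \<in> carrier_mat n n" "P * R = 1\<^sub>m n" "R * P = 1\<^sub>m n"
  shows "invertible_mat P"
  using assms unfolding invertible_mat_def inverts_mat_def square_mat.simps by auto

lemma diag_pencil_Cons:
  "fst (diag_pencil (b # bs)) =
    four_block_mat (fst (block_pencil b))
      (0\<^sub>m (dim_row (fst (block_pencil b))) (dim_col (fst (diag_pencil bs))))
      (0\<^sub>m (dim_row (fst (diag_pencil bs))) (dim_col (fst (block_pencil b)))) (fst (diag_pencil bs))"
  "snd (diag_pencil (b # bs)) =
    four_block_mat (snd (block_pencil b))
      (0\<^sub>m (dim_row (snd (block_pencil b))) (dim_col (snd (diag_pencil bs))))
      (0\<^sub>m (dim_row (snd (diag_pencil bs))) (dim_col (snd (block_pencil b)))) (snd (diag_pencil bs))"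
  by (simp_all add: diag_pencil_def Let_def)

lemma items_represent:
  assumes "\<forall>(b, vs, ws) \<in> set items. coords.chain A B b vs ws"
  shows "coords.represents A (fst (diag_pencil (map fst items)))
      (coords.domain_list items) (coords.codomain_list items)"
    "coords.represents B (snd (diag_pencil (map fst items)))
      (coords.domain_list items) (coords.codomain_list items)"
proof -
  have "coords.represents A (fst (diag_pencil (map fst items)))
      (coords.domain_list items) (coords.codomain_list items) \<and>
    coords.represents B (snd (diag_pencil (map fst items)))
      (coords.domain_list items) (coords.codomain_list items)"
    using assms
  proof (induction items)
    case Nil
    then show ?case by (simp add: diag_pencil_def coords.represents_def)
  next
    case (Cons it items)
    obtain b vs ws where it: "it = (b, vs, ws)" by (cases it)
    have c: "coords.chain A B b vs ws" using Cons.prems it by simp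
    have IH: "coords.represents A (fst (diag_pencil (map fst items)))
        (coords.domain_list items) (coords.codomain_list items)"
      "coords.represents B (snd (diag_pencil (map fst items)))
        (coords.domain_list items) (coords.codomain_list items)"
      using Cons by simp_all
    show ?case
      using coords.represents_block_diagonal[OF coords.chain_represents(1)[OF c] IH(1)]
        coords.represents_block_diagonal[OF coords.chain_represents(2)[OF c] IH(2)]
      unfolding it list.map fst_conv diag_pencil_Cons coords.domain_list_simps
        coords.codomain_list_simps by (rule conjI)
  qed
  then show "coords.represents A (fst (diag_pencil (map fst items)))
      (coords.domain_list items) (coords.codomain_list items)"
    "coords.represents B (snd (diag_pencil (map fst items)))
      (coords.domain_list items) (coords.codomain_list items)" by auto
qed

text \<open>
  The bases of \<open>\<complex>\<^sup>n\<close> and \<open>\<complex>\<^sup>m\<close> that consist of chains are the columns of \<open>Q\<close> and \<open>P\<close>; then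
  \<open>P\<^sup>-\<^sup>1 L Q\<close> is block diagonal.
\<close>

theorem kcf_exists:
  assumes "L \<in> pencils m n"
  shows "\<exists>bs. is_kcf L bs"
proof -
  have dims: "fst L \<in> carrier_mat m n" "snd L \<in> carrier_mat m n"
    using assms by (auto simp: pencils_def)
  then have nr: "nrows L = m" "ncols L = n" by (auto simp: nrows_def ncols_def)
  let ?A = "mat_fun (fst L)" and ?B = "mat_fun (snd L)"
  have fd: "coords.vs1.fin_dim (first_coords k)" for k
    using unit_fun_basis by (rule coords.vs1.basis_list_fin_dim)
  have "?A ` first_coords n \<subseteq> first_coords m" "?B ` first_coords n \<subseteq> first_coords m"
    using dims by (auto simp: mat_fun_def first_coords_def)
  then obtain items where items: "coords.decomposes ?A ?B (first_coords n) (first_coords m) items"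
    using coords.kronecker_decomposition[OF linear_mat_fun linear_mat_fun fd fd] by meson
  let ?vs = "coords.domain_list items" and ?ws = "coords.codomain_list items"
  define bs where "bs = map fst items"
  have ch: "\<forall>(b, vs, ws) \<in> set items. coords.chain ?A ?B b vs ws"
    and vs: "coords.vs1.basis_list (first_coords n) ?vs"
    and ws: "coords.vs1.basis_list (first_coords m) ?ws"
    using items by (auto simp: coords.decomposes_def)
  have len: "length ?vs = n" "length ?ws = m"
    using coords.vs1.basis_list_length[OF vs] coords.vs1.basis_list_length[OF unit_fun_basis[of n]]
      coords.vs1.basis_list_length[OF ws] coords.vs1.basis_list_length[OF unit_fun_basis[of m]]
    by simp_all
  define Q where "Q = mat n n (\<lambda>(i, j). (?vs ! j) i)"
  define P where "P = mat m m (\<lambda>(i, j). (?ws ! j) i)"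
  have QP: "Q \<in> carrier_mat n n" "P \<in> carrier_mat m m" by (auto simp: Q_def P_def)
  obtain Q' where Q': "Q' \<in> carrier_mat n n" "Q * Q' = 1\<^sub>m n" "Q' * Q = 1\<^sub>m n"
    using basis_matrix_inverse[OF vs] unfolding Q_def by metis
  obtain P' where P': "P' \<in> carrier_mat m m" "P * P' = 1\<^sub>m m" "P' * P = 1\<^sub>m m"
    using basis_matrix_inverse[OF ws] unfolding P_def by metis
  have key: "X = P' * Y * Q" if rep: "coords.represents (mat_fun Y) X ?vs ?ws"
    and Y: "Y \<in> carrier_mat m n" for X Y
  proof -
    have X: "X \<in> carrier_mat m n" using rep len by (simp add: coords.represents_def)
    have "Y * Q = P * X"
    proof (rule eq_matI)
      fix i j assume "i < dim_row (P * X)" "j < dim_col (P * X)"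
      then have ij: "i < m" "j < n" using X QP by auto
      have "mat_fun Y (?vs ! j) i = (\<Sum>l<m. cscale (X $$ (l, j)) (?ws ! l)) i"
        using rep ij len by (simp add: coords.represents_def)
      then have "(\<Sum>k<n. Y $$ (i, k) * (?vs ! j) k) = (\<Sum>l<m. X $$ (l, j) * (?ws ! l) i)"
        using ij Y by (simp add: mat_fun_def fun_sum_apply cscale_def)
      then show "(Y * Q) $$ (i, j) = (P * X) $$ (i, j)"
        using ij X Y by (simp add: Q_def P_def scalar_prod_def atLeast0LessThan mult.commute)
    qed (use X Y QP in auto)
    then have "P' * Y * Q = (P' * P) * X"
      unfolding assoc_mult_mat[OF P'(1) Y QP(1)] assoc_mult_mat[OF P'(1) QP(2) X] by (rule arg_cong)
    then show ?thesis using P'(3) X by simp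
  qed
  have "diag_pencil bs = (P' * fst L * Q, P' * snd L * Q)"
    unfolding bs_def
    by (rule prod_eqI; unfold fst_conv snd_conv)
      (rule key[OF items_represent(1)[OF ch] dims(1)] key[OF items_represent(2)[OF ch] dims(2)])+
  moreover have "invertible_mat P'" "invertible_mat Q"
    using invertible_matI[OF P'(1) QP(2) P'(3,2)] invertible_matI[OF QP(1) Q'] by auto
  ultimately have "diag_pencil bs \<in> strict_orbit L"
    unfolding strict_orbit_def nr using P'(1) QP(1)
    by (intro CollectI exI[of _ P'] exI[of _ Q] conjI)
  moreover have "k \<ge> 1" if "Jordan k \<mu> \<in> set bs" for k \<mu>
  proof -
    from that obtain it where "it \<in> set items" "fst it = Jordan k \<mu>"
      by (auto simp: bs_def)
    then have "coords.chain ?A ?B (Jordan k \<mu>) (fst (snd it)) (snd (snd it))"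
      using ch by (auto simp: case_prod_beta)
    then show ?thesis by (cases \<mu>) auto
  qed
  ultimately show ?thesis unfolding is_kcf_def by blast
qed

section \<open>The rank of a pencil in terms of its blocks\<close>

text \<open>
  \<open>R = X Y\<close> with \<open>X\<close> left invertible and \<open>Y\<close> right invertible.  Unlike the dimension of the column
  space, this form of ``rank \<open>\<rho>\<close>'' is inherited by direct sums, transposes and equivalent matrices
  through plain matrix algebra.
\<close>

definition rank_factorization :: "'a::field mat \<Rightarrow> nat \<Rightarrow> bool" where
  "rank_factorization R \<rho> \<longleftrightarrow> (\<exists>X Y Z T.
     X \<in> carrier_mat (dim_row R) \<rho> \<and> Y \<in> carrier_mat \<rho> (dim_col R) \<and>
     Z \<in> carrier_mat \<rho> (dim_row R) \<and> T \<in> carrier_mat (dim_col R) \<rho> \<and>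
     R = X * Y \<and> Z * X = 1\<^sub>m \<rho> \<and> Y * T = 1\<^sub>m \<rho>)"

lemma rank_factorizationI:
  assumes "R \<in> carrier_mat m n" "X \<in> carrier_mat m \<rho>" "Y \<in> carrier_mat \<rho> n"
    "Z \<in> carrier_mat \<rho> m" "T \<in> carrier_mat n \<rho>" "R = X * Y" "Z * X = 1\<^sub>m \<rho>" "Y * T = 1\<^sub>m \<rho>"
  shows "rank_factorization R \<rho>"
  unfolding rank_factorization_def carrier_matD[OF assms(1)] by (intro exI conjI) (rule assms(2-))+

lemma rank_factorizationE:
  assumes "rank_factorization R \<rho>" "R \<in> carrier_mat m n"
  obtains X Y Z T where "X \<in> carrier_mat m \<rho>" "Y \<in> carrier_mat \<rho> n"
    "Z \<in> carrier_mat \<rho> m" "T \<in> carrier_mat n \<rho>" "R = X * Y" "Z * X = 1\<^sub>m \<rho>" "Y * T = 1\<^sub>m \<rho>"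
  using assms(1) unfolding rank_factorization_def carrier_matD[OF assms(2)]
  by (elim exE conjE) (rule that)

lemma rank_left_invertible:
  fixes X :: "'a::field mat"
  assumes X: "X \<in> carrier_mat m \<rho>" and Z: "Z \<in> carrier_mat \<rho> m" and ZX: "Z * X = 1\<^sub>m \<rho>"
  shows "vec_space.rank m X = \<rho>"
proof -
  interpret vec_space "TYPE('a)" m .
  have dist: "distinct (cols X)"
    unfolding distinct_conv_nth
  proof (intro allI impI notI)
    fix i j assume ij: "i < length (cols X)" "j < length (cols X)" "i \<noteq> j" "cols X ! i = cols X ! j"
    then have less: "i < \<rho>" "j < \<rho>" and "col X i = col X j" using X by auto
    then have "col (Z * X) i = col (Z * X) j"
      unfolding col_mult2[OF Z X less(1)] col_mult2[OF Z X less(2)] by simp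
    then have "col (1\<^sub>m \<rho> :: 'a mat) i $ i = col (1\<^sub>m \<rho>) j $ i" unfolding ZX by simp
    then show False using less ij(3) by simp
  qed
  have "lin_indpt (set (cols X))"
  proof
    assume "lin_dep (set (cols X))"
    then obtain v where v: "v \<in> carrier_vec \<rho>" "v \<noteq> 0\<^sub>v \<rho>" "X *\<^sub>v v = 0\<^sub>v m"
      by (rule lin_depE[OF X _ dist])
    have "v = (Z * X) *\<^sub>v v" using ZX v by simp
    also have "\<dots> = Z *\<^sub>v (X *\<^sub>v v)" using assoc_mult_mat_vec[OF Z X v(1)] .
    also have "\<dots> = 0\<^sub>v \<rho>" unfolding v(3) using Z by (intro eq_vecI) auto
    finally show False using v(2) by simp
  qed
  then show ?thesis using lin_indpt_full_rank[OF X dist] by simp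
qed

text \<open>
  \<open>R = X Y\<close> and \<open>X = R T\<close> show that \<open>R\<close> and \<open>X\<close> have the same column space.
\<close>

lemma rank_factorization_rank:
  fixes R :: "'a::field mat"
  assumes fact: "rank_factorization R \<rho>" and R: "R \<in> carrier_mat m n"
  shows "vec_space.rank m R = \<rho>"
proof -
  obtain X Y Z T where F: "X \<in> carrier_mat m \<rho>" "Y \<in> carrier_mat \<rho> n"
    "Z \<in> carrier_mat \<rho> m" "T \<in> carrier_mat n \<rho>" "R = X * Y" "Z * X = 1\<^sub>m \<rho>" "Y * T = 1\<^sub>m \<rho>"
    by (rule rank_factorizationE[OF fact R])
  interpret vec_space "TYPE('a)" m .
  have RT: "R * T = X"
    unfolding F(5) assoc_mult_mat[OF F(1,2,4)] F(7) by (rule right_mult_one_mat[OF F(1)])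
  have "col_space R = col_space X"
  proof
    show "col_space R \<subseteq> col_space X"
    proof
      fix y assume "y \<in> col_space R"
      then obtain x where x: "x \<in> carrier_vec n" "R *\<^sub>v x = y" "y \<in> carrier_vec m"
        using R unfolding col_space_eq[OF R] by auto
      then have "X *\<^sub>v (Y *\<^sub>v x) = y"
        using assoc_mult_mat_vec[OF F(1,2) x(1)] by (simp only: F(5))
      moreover have "Y *\<^sub>v x \<in> carrier_vec \<rho>" using F(2) x(1) by (rule mult_mat_vec_carrier)
      ultimately show "y \<in> col_space X" using F(1) x(3) unfolding col_space_eq[OF F(1)] by auto
    qed
    show "col_space X \<subseteq> col_space R"
    proof
      fix y assume "y \<in> col_space X"
      then obtain x where x: "x \<in> carrier_vec \<rho>" "X *\<^sub>v x = y" "y \<in> carrier_vec m"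
        using F(1) unfolding col_space_eq[OF F(1)] by auto
      then have "R *\<^sub>v (T *\<^sub>v x) = y"
        using assoc_mult_mat_vec[OF R F(4) x(1)] by (simp only: RT)
      moreover have "T *\<^sub>v x \<in> carrier_vec n" using F(4) x(1) by (rule mult_mat_vec_carrier)
      ultimately show "y \<in> col_space R" using R x(3) unfolding col_space_eq[OF R] by auto
    qed
  qed
  then have "rank R = rank X" unfolding rank_def col_space_def by simp
  then show ?thesis using rank_left_invertible[OF F(1,3,6)] by simp
qed

lemma mult_mat_regroup:
  fixes A :: "'a::semiring_0 mat"
  assumes "A \<in> carrier_mat a b" "B \<in> carrier_mat b c" "C \<in> carrier_mat c d" "D \<in> carrier_mat d e"
  shows "(A * B) * (C * D) = A * (B * C) * D"
  unfolding assoc_mult_mat[OF assms(1,2) mult_carrier_mat[OF assms(3,4)]]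
    assoc_mult_mat[OF assms(2-4), symmetric]
    assoc_mult_mat[OF assms(1) mult_carrier_mat[OF assms(2,3)] assms(4)] ..

lemma rank_factorization_equiv:
  assumes fact: "rank_factorization R \<rho>" and R: "R \<in> carrier_mat m n"
    and P: "P \<in> carrier_mat m m" "P' \<in> carrier_mat m m" "P' * P = 1\<^sub>m m"
    and Q: "Q \<in> carrier_mat n n" "Q' \<in> carrier_mat n n" "Q * Q' = 1\<^sub>m n"
  shows "rank_factorization (P * R * Q) \<rho>"
proof -
  obtain X Y Z T where F: "X \<in> carrier_mat m \<rho>" "Y \<in> carrier_mat \<rho> n"
    "Z \<in> carrier_mat \<rho> m" "T \<in> carrier_mat n \<rho>" "R = X * Y" "Z * X = 1\<^sub>m \<rho>" "Y * T = 1\<^sub>m \<rho>"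
    by (rule rank_factorizationE[OF fact R])
  show ?thesis
  proof (rule rank_factorizationI)
    show "P * R * Q \<in> carrier_mat m n" "P * X \<in> carrier_mat m \<rho>" "Y * Q \<in> carrier_mat \<rho> n"
      "Z * P' \<in> carrier_mat \<rho> m" "Q' * T \<in> carrier_mat n \<rho>" using F R P Q by auto
    show "P * R * Q = (P * X) * (Y * Q)"
      unfolding F(5) by (rule mult_mat_regroup[OF P(1) F(1,2) Q(1), symmetric])
    show "(Z * P') * (P * X) = 1\<^sub>m \<rho>"
      unfolding mult_mat_regroup[OF F(3) P(2,1) F(1)] P(3) using F(3,6) by simp
    show "(Y * Q) * (Q' * T) = 1\<^sub>m \<rho>"
      unfolding mult_mat_regroup[OF F(2) Q(1,2) F(4)] Q(3) using F(2,7) by simp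
  qed
qed

lemma mult_block_diagonal:
  fixes A1 :: "'a::field mat"
  assumes "A1 \<in> carrier_mat a b" "A2 \<in> carrier_mat a' b'" "B1 \<in> carrier_mat b c" "B2 \<in> carrier_mat b' c'"
  shows "four_block_mat A1 (0\<^sub>m a b') (0\<^sub>m a' b) A2 * four_block_mat B1 (0\<^sub>m b c') (0\<^sub>m b' c) B2 =
    four_block_mat (A1 * B1) (0\<^sub>m a c') (0\<^sub>m a' c) (A2 * B2)"
  using assms by (subst mult_four_block_mat[where ?nr1.0 = a and ?n1.0 = b and ?n2.0 = b' and ?nr2.0 = a'
        and ?nc1.0 = c and ?nc2.0 = c']) auto

lemma rank_factorization_block_diagonal:
  assumes fact: "rank_factorization R1 \<rho>1" "rank_factorization R2 \<rho>2"
    and R: "R1 \<in> carrier_mat m1 n1" "R2 \<in> carrier_mat m2 n2"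
  shows "rank_factorization (four_block_mat R1 (0\<^sub>m m1 n2) (0\<^sub>m m2 n1) R2) (\<rho>1 + \<rho>2)"
proof -
  obtain X1 Y1 Z1 T1 where F1: "X1 \<in> carrier_mat m1 \<rho>1" "Y1 \<in> carrier_mat \<rho>1 n1"
    "Z1 \<in> carrier_mat \<rho>1 m1" "T1 \<in> carrier_mat n1 \<rho>1" "R1 = X1 * Y1" "Z1 * X1 = 1\<^sub>m \<rho>1" "Y1 * T1 = 1\<^sub>m \<rho>1"
    by (rule rank_factorizationE[OF fact(1) R(1)])
  obtain X2 Y2 Z2 T2 where F2: "X2 \<in> carrier_mat m2 \<rho>2" "Y2 \<in> carrier_mat \<rho>2 n2"
    "Z2 \<in> carrier_mat \<rho>2 m2" "T2 \<in> carrier_mat n2 \<rho>2" "R2 = X2 * Y2" "Z2 * X2 = 1\<^sub>m \<rho>2" "Y2 * T2 = 1\<^sub>m \<rho>2"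
    by (rule rank_factorizationE[OF fact(2) R(2)])
  show ?thesis
  proof (rule rank_factorizationI)
    show "four_block_mat R1 (0\<^sub>m m1 n2) (0\<^sub>m m2 n1) R2 =
        four_block_mat X1 (0\<^sub>m m1 \<rho>2) (0\<^sub>m m2 \<rho>1) X2 * four_block_mat Y1 (0\<^sub>m \<rho>1 n2) (0\<^sub>m \<rho>2 n1) Y2"
      using mult_block_diagonal[OF F1(1) F2(1) F1(2) F2(2)] F1(5) F2(5) by simp
    show "four_block_mat Z1 (0\<^sub>m \<rho>1 m2) (0\<^sub>m \<rho>2 m1) Z2 * four_block_mat X1 (0\<^sub>m m1 \<rho>2) (0\<^sub>m m2 \<rho>1) X2 = 1\<^sub>m (\<rho>1 + \<rho>2)"
      using mult_block_diagonal[OF F1(3) F2(3) F1(1) F2(1)] F1(6) F2(6) by simp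
    show "four_block_mat Y1 (0\<^sub>m \<rho>1 n2) (0\<^sub>m \<rho>2 n1) Y2 * four_block_mat T1 (0\<^sub>m n1 \<rho>2) (0\<^sub>m n2 \<rho>1) T2 = 1\<^sub>m (\<rho>1 + \<rho>2)"
      using mult_block_diagonal[OF F1(2) F2(2) F1(4) F2(4)] F1(7) F2(7) by simp
  qed (use F1 F2 R in auto)
qed

lemma rank_factorization_triangular:
  fixes R :: "'a::field mat"
  assumes "R \<in> carrier_mat k k" "upper_triangular R" "\<And>i. i < k \<Longrightarrow> R $$ (i, i) \<noteq> 0"
  shows "rank_factorization R k"
proof -
  have "det R = prod_list (diag_mat R)" using assms(2,1) by (rule det_upper_triangular)
  also have "\<dots> \<noteq> 0" using assms(1,3) by (auto simp: prod_list_zero_iff diag_mat_def)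
  finally have "R \<in> Units (ring_mat TYPE('a) k ())" by (rule det_non_zero_imp_unit[OF assms(1)])
  then obtain R' where R': "R' \<in> carrier_mat k k" "R' * R = 1\<^sub>m k" "R * R' = 1\<^sub>m k"
    by (auto simp: Units_def ring_mat_def)
  show ?thesis
    by (rule rank_factorizationI[of _ k k R _ "1\<^sub>m k" R' "1\<^sub>m k"]) (use assms(1) R' in auto)
qed

lemma rank_factorization_transpose:
  assumes "rank_factorization R \<rho>" shows "rank_factorization R\<^sup>T \<rho>"
proof -
  have R: "R \<in> carrier_mat (dim_row R) (dim_col R)" by simp
  obtain X Y Z T where F: "X \<in> carrier_mat (dim_row R) \<rho>" "Y \<in> carrier_mat \<rho> (dim_col R)"
    "Z \<in> carrier_mat \<rho> (dim_row R)" "T \<in> carrier_mat (dim_col R) \<rho>" "R = X * Y" "Z * X = 1\<^sub>m \<rho>" "Y * T = 1\<^sub>m \<rho>"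
    by (rule rank_factorizationE[OF assms R])
  show ?thesis
  proof (rule rank_factorizationI)
    show "R\<^sup>T \<in> carrier_mat (dim_col R) (dim_row R)" "Y\<^sup>T \<in> carrier_mat (dim_col R) \<rho>"
      "X\<^sup>T \<in> carrier_mat \<rho> (dim_row R)" "T\<^sup>T \<in> carrier_mat \<rho> (dim_col R)" "Z\<^sup>T \<in> carrier_mat (dim_row R) \<rho>"
      unfolding transpose_carrier_mat by (rule R F)+
    show "R\<^sup>T = Y\<^sup>T * X\<^sup>T"
      unfolding transpose_mult[OF F(1,2), symmetric] F(5)[symmetric] ..
    show "T\<^sup>T * Y\<^sup>T = 1\<^sub>m \<rho>"
      unfolding transpose_mult[OF F(2,4), symmetric] F(7) transpose_one ..
    show "X\<^sup>T * Z\<^sup>T = 1\<^sub>m \<rho>"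
      unfolding transpose_mult[OF F(3,1), symmetric] F(6) transpose_one ..
  qed
qed

fun block_rank :: "kblock \<Rightarrow> nat" where
  "block_rank (Jordan k \<mu>) = k"
| "block_rank (RSing k) = k"
| "block_rank (LSing k) = k"

lemma rational_mat_carrier: "rational_mat L \<in> carrier_mat (nrows L) (ncols L)"
  by (simp add: rational_mat_def)

lemma rank_factorization_rsing: "rank_factorization (rational_mat (block_pencil (RSing k))) k"
proof -
  define R where "R = rational_mat (block_pencil (RSing k))"
  define x :: "complex poly fract" where "x = to_fract [:0, 1:]"
  \<comment> \<open>Column \<open>j\<close> of \<open>T\<close> solves the recursion \<open>x t\<^sub>i + t\<^sub>i\<^sub>+\<^sub>1 = \<delta>\<^sub>i\<^sub>j\<close> with \<open>t\<^sub>0 = 0\<close>.\<close>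
  define T where "T = mat (k + 1) k (\<lambda>(i, j). if j < i then (- x) ^ (i - 1 - j) else 0)"
  have R: "R \<in> carrier_mat k (k + 1)" by (simp add: R_def rational_mat_def nrows_def ncols_def)
  have Rij: "R $$ (i, j) = (if j = i then x else if j = i + 1 then 1 else 0)"
    if "i < k" "j < k + 1" for i j
    using that by (simp add: R_def rational_mat_def nrows_def ncols_def x_def flip: one_pCons)
  have "R * T = 1\<^sub>m k"
  proof (rule eq_matI)
    fix i j assume "i < dim_row (1\<^sub>m k)" "j < dim_col (1\<^sub>m k)"
    then have ij: "i < k" "j < k" by auto
    have "(R * T) $$ (i, j) = (\<Sum>l<k + 1. R $$ (i, l) * T $$ (l, j))"
      using ij R by (simp add: scalar_prod_def T_def atLeast0LessThan)
    also have "\<dots> = (\<Sum>l<k + 1. (if l = i then x * T $$ (i, j) else 0) + (if l = i + 1 then T $$ (i + 1, j) else 0))"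
      using ij by (intro sum.cong) (auto simp: Rij)
    also have "\<dots> = x * T $$ (i, j) + T $$ (i + 1, j)"
      using ij by (simp add: sum.distrib sum.delta)
    also have "\<dots> = (if i = j then 1 else 0)"
    proof -
      consider "i < j" | "i = j" | "j < i" by linarith
      then show ?thesis
      proof cases
        case 3
        then have "i - j = Suc (i - 1 - j)" by simp
        then show ?thesis using ij 3 by (simp add: T_def)
      qed (use ij in \<open>auto simp: T_def\<close>)
    qed
    finally show "(R * T) $$ (i, j) = 1\<^sub>m k $$ (i, j)" using ij by simp
  qed (use R in \<open>auto simp: T_def\<close>)
  then show ?thesis
    unfolding R_def[symmetric]
    by (intro rank_factorizationI[of _ k "k + 1" "1\<^sub>m k" _ R "1\<^sub>m k" T]) (use R in \<open>auto simp: T_def\<close>)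
qed

lemma rank_factorization_block: "rank_factorization (rational_mat (block_pencil b)) (block_rank b)"
proof (cases b)
  case (Jordan k \<mu>)
  show ?thesis
  proof (cases \<mu>)
    case (Finite z)
    show ?thesis unfolding Jordan Finite block_rank.simps
      by (rule rank_factorization_triangular)
        (auto simp: rational_mat_def nrows_def ncols_def jordan_block_def)
  next
    case Infinity
    show ?thesis unfolding Jordan Infinity block_rank.simps
      by (rule rank_factorization_triangular)
        (auto simp: rational_mat_def nrows_def ncols_def jordan_block_def)
  qed
next
  case (RSing k)
  then show ?thesis using rank_factorization_rsing by simp
next
  case (LSing k)
  have "rational_mat (block_pencil (LSing k)) = (rational_mat (block_pencil (RSing k)))\<^sup>T"
    by (rule eq_matI) (auto simp: rational_mat_def nrows_def ncols_def)
  then show ?thesis using rank_factorization_transpose[OF rank_factorization_rsing] LSing by simp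
qed

lemma block_pencil_dims: "dim_row (snd (block_pencil b)) = dim_row (fst (block_pencil b))"
  "dim_col (snd (block_pencil b)) = dim_col (fst (block_pencil b))"
  by (cases b rule: block_pencil.cases; simp)+

lemma diag_pencil_dims: "dim_row (snd (diag_pencil bs)) = dim_row (fst (diag_pencil bs))"
  "dim_col (snd (diag_pencil bs)) = dim_col (fst (diag_pencil bs))"
  by (simp_all add: diag_pencil_def dim_diag_block_mat block_pencil_dims comp_def)

lemma rank_factorization_diag_pencil:
  "rank_factorization (rational_mat (diag_pencil bs)) (sum_list (map block_rank bs))"
proof (induction bs)
  case Nil
  show ?case
    by (rule rank_factorizationI[of _ 0 0 "1\<^sub>m 0" _ "1\<^sub>m 0" "1\<^sub>m 0" "1\<^sub>m 0"])
      (auto simp: diag_pencil_def rational_mat_def nrows_def ncols_def)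
next
  case (Cons b bs)
  let ?m = "nrows (block_pencil b)" and ?n = "ncols (block_pencil b)"
  let ?m' = "nrows (diag_pencil bs)" and ?n' = "ncols (diag_pencil bs)"
  have "rational_mat (diag_pencil (b # bs)) =
      four_block_mat (rational_mat (block_pencil b)) (0\<^sub>m ?m ?n') (0\<^sub>m ?m' ?n) (rational_mat (diag_pencil bs))"
    by (rule eq_matI)
      (auto simp: rational_mat_def nrows_def ncols_def diag_pencil_Cons diag_pencil_dims block_pencil_dims)
  then show ?case
    using rank_factorization_block_diagonal[OF rank_factorization_block[of b] Cons.IH
        rational_mat_carrier rational_mat_carrier] by simp
qed

definition const_mat :: "complex mat \<Rightarrow> complex poly fract mat" where
  "const_mat P = map_mat (\<lambda>c. to_fract [:c:]) P"

lemma to_fract_linear_sum: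
  "to_fract [:\<Sum>k\<in>S. f k * a k, \<Sum>k\<in>S. f k * b k:] = (\<Sum>k\<in>S. to_fract [:f k:] * to_fract [:a k, b k:])"
proof -
  have "[:\<Sum>k\<in>S. f k * a k, \<Sum>k\<in>S. f k * b k:] = (\<Sum>k\<in>S. [:f k:] * [:a k, b k:])"
  proof (induction S rule: infinite_finite_induct)
    case (insert x F)
    show ?case unfolding sum.insert[OF insert(1,2)] insert(3)[symmetric] by simp
  qed simp_all
  then show ?thesis by (simp only: to_fract_sum to_fract_mult)
qed

lemma rational_mat_mult_left:
  assumes "P \<in> carrier_mat l m" "A \<in> carrier_mat m n" "B \<in> carrier_mat m n"
  shows "rational_mat (P * A, P * B) = const_mat P * rational_mat (A, B)"
  using assms
  by (intro eq_matI)
    (auto simp: rational_mat_def const_mat_def nrows_def ncols_def scalar_prod_def to_fract_linear_sum)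

lemma rational_mat_mult_right:
  assumes "Q \<in> carrier_mat n l" "A \<in> carrier_mat m n" "B \<in> carrier_mat m n"
  shows "rational_mat (A * Q, B * Q) = rational_mat (A, B) * const_mat Q"
proof (rule eq_matI)
  fix i j assume "i < dim_row (rational_mat (A, B) * const_mat Q)" "j < dim_col (rational_mat (A, B) * const_mat Q)"
  then have ij: "i < m" "j < l" using assms by (auto simp: rational_mat_def const_mat_def nrows_def)
  have "rational_mat (A * Q, B * Q) $$ (i, j) =
      to_fract [:\<Sum>k<n. Q $$ (k, j) * A $$ (i, k), \<Sum>k<n. Q $$ (k, j) * B $$ (i, k):]"
    using ij assms by (simp add: rational_mat_def nrows_def ncols_def scalar_prod_def atLeast0LessThan mult.commute)
  also have "\<dots> = (rational_mat (A, B) * const_mat Q) $$ (i, j)"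
    unfolding to_fract_linear_sum using ij assms
    by (simp add: rational_mat_def const_mat_def nrows_def ncols_def scalar_prod_def atLeast0LessThan mult.commute)
  finally show "rational_mat (A * Q, B * Q) $$ (i, j) = (rational_mat (A, B) * const_mat Q) $$ (i, j)" .
qed (use assms in \<open>auto simp: rational_mat_def const_mat_def nrows_def ncols_def\<close>)

lemma const_mat_eq_rational: "P \<in> carrier_mat m n \<Longrightarrow> const_mat P = rational_mat (P, 0\<^sub>m m n)"
  by (intro eq_matI) (auto simp: const_mat_def rational_mat_def nrows_def ncols_def)

lemma const_mat_inverse:
  assumes "P \<in> carrier_mat n n" "R \<in> carrier_mat n n" "P * R = 1\<^sub>m n"
  shows "const_mat P * const_mat R = 1\<^sub>m n"
proof -
  have "const_mat P * const_mat R = rational_mat (P * R, P * 0\<^sub>m n n)"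
    using rational_mat_mult_left[OF assms(1,2), of "0\<^sub>m n n"] const_mat_eq_rational[OF assms(2)] by simp
  also have "\<dots> = 1\<^sub>m n"
    using assms by (intro eq_matI) (auto simp: rational_mat_def nrows_def ncols_def one_pCons[symmetric])
  finally show ?thesis .
qed

lemma invertible_matE:
  fixes P :: "'a::field mat"
  assumes "invertible_mat P" "P \<in> carrier_mat n n"
  obtains R where "R \<in> carrier_mat n n" "P * R = 1\<^sub>m n" "R * P = 1\<^sub>m n"
proof -
  obtain R where R: "P * R = 1\<^sub>m (dim_row P)" "R * P = 1\<^sub>m (dim_row R)"
    using assms(1) by (auto simp: invertible_mat_def inverts_mat_def)
  have "dim_col R = n" using arg_cong[OF R(1), of dim_col] assms(2) by simp
  moreover have "dim_row R = n" using arg_cong[OF R(2), of dim_col] assms(2) by simp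
  ultimately show ?thesis using that[of R] R assms(2) by auto
qed

theorem kcf_sizes:
  assumes L: "L \<in> pencils m n" and bs: "is_kcf L bs"
  shows "sum_list (map (nrows \<circ> block_pencil) bs) = m"
    and "sum_list (map (ncols \<circ> block_pencil) bs) = n"
    and "pencil_rank L = sum_list (map block_rank bs)"
proof -
  have dims: "fst L \<in> carrier_mat m n" "snd L \<in> carrier_mat m n"
    using L by (auto simp: pencils_def)
  then have nr: "nrows L = m" "ncols L = n" by (auto simp: nrows_def ncols_def)
  from bs obtain P Q where D: "diag_pencil bs = (P * fst L * Q, P * snd L * Q)"
    and P: "P \<in> carrier_mat m m" "invertible_mat P" and Q: "Q \<in> carrier_mat n n" "invertible_mat Q"
    unfolding is_kcf_def strict_orbit_def nr by auto
  have dd: "dim_row (fst (diag_pencil bs)) = m" "dim_col (fst (diag_pencil bs)) = n"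
    using D dims P Q by auto
  then show "sum_list (map (nrows \<circ> block_pencil) bs) = m" "sum_list (map (ncols \<circ> block_pencil) bs) = n"
    by (simp_all add: diag_pencil_def dim_diag_block_mat comp_def nrows_def ncols_def)
  obtain P' where P': "P' \<in> carrier_mat m m" "P * P' = 1\<^sub>m m" "P' * P = 1\<^sub>m m"
    using invertible_matE[OF P(2,1)] by metis
  obtain Q' where Q': "Q' \<in> carrier_mat n n" "Q * Q' = 1\<^sub>m n" "Q' * Q = 1\<^sub>m n"
    using invertible_matE[OF Q(2,1)] by metis
  have undo: "P' * (P * A * Q) * Q' = A" if A: "A \<in> carrier_mat m n" for A
  proof -
    have "P' * (P * A * Q) * Q' = (P' * (P * A)) * (Q * Q')"
      using P P' A Q Q' by (intro mult_mat_regroup[symmetric]) auto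
    also have "P' * (P * A) = (P' * P) * A"
      using assoc_mult_mat[OF P'(1) P(1) A] by simp
    finally show ?thesis using A P'(3) Q'(2) by simp
  qed
  have DM: "P * fst L * Q \<in> carrier_mat m n" "P * snd L * Q \<in> carrier_mat m n"
    using P Q dims by auto
  have "rational_mat L = rational_mat (P' * (P * fst L * Q) * Q', P' * (P * snd L * Q) * Q')"
    by (simp add: undo dims)
  also have "\<dots> = rational_mat (P' * (P * fst L * Q), P' * (P * snd L * Q)) * const_mat Q'"
    by (rule rational_mat_mult_right[OF Q'(1) mult_carrier_mat[OF P'(1) DM(1)] mult_carrier_mat[OF P'(1) DM(2)]])
  also have "\<dots> = const_mat P' * rational_mat (diag_pencil bs) * const_mat Q'"
    unfolding D using rational_mat_mult_left[OF P'(1) DM] by simp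
  finally have RL: "rational_mat L = const_mat P' * rational_mat (diag_pencil bs) * const_mat Q'" .
  have "rank_factorization (rational_mat L) (sum_list (map block_rank bs))"
    unfolding RL
  proof (rule rank_factorization_equiv[OF rank_factorization_diag_pencil])
    show "rational_mat (diag_pencil bs) \<in> carrier_mat m n"
      using rational_mat_carrier[of "diag_pencil bs"] dd by (simp add: nrows_def ncols_def)
    show "const_mat P * const_mat P' = 1\<^sub>m m" "const_mat Q' * const_mat Q = 1\<^sub>m n"
      using const_mat_inverse P P' Q Q' by auto
  qed (use P P' Q Q' in \<open>auto simp: const_mat_def\<close>)
  then show "pencil_rank L = sum_list (map block_rank bs)"
    unfolding pencil_rank_def by (rule rank_factorization_rank[OF _ rational_mat_carrier])
qed

section \<open>Inequalities between monotone sequences\<close>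

text \<open>
  Summation by parts writes the sum as a combination of partial sums of \<open>x\<close> whose coefficients
  \<open>s\<^sub>i - s\<^sub>i\<^sub>+\<^sub>1\<close> are nonnegative.
\<close>

lemma abel_nonneg:
  fixes x s :: "nat \<Rightarrow> int"
  assumes "\<And>j. 0 \<le> (\<Sum>i<j. x i)" "\<And>i. s (Suc i) \<le> s i" "\<And>i. 0 \<le> s i"
  shows "0 \<le> (\<Sum>i<n. x i * s i)"
proof -
  have "(\<Sum>i<n. x i * s i) = (\<Sum>i<n. (\<Sum>j<Suc i. x j) * (s i - s (Suc i))) + (\<Sum>i<n. x i) * s n"
    by (induction n) (simp_all add: algebra_simps)
  moreover have "0 \<le> (\<Sum>i<n. (\<Sum>j<Suc i. x j) * (s i - s (Suc i)))"
    by (intro sum_nonneg mult_nonneg_nonneg[OF assms(1)]) (simp add: assms(2))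
  moreover have "0 \<le> (\<Sum>i<n. x i) * s n" using assms by simp
  ultimately show ?thesis by simp
qed

text \<open>
  \<open>S\<close> is the sum of \<open>(w'\<^sub>i - w\<^sub>i + h) (w\<^sub>i + w'\<^sub>i)\<close>: the first factor has nonnegative partial sums by
  majorization and the second is decreasing and nonnegative.  For \<open>h = 0\<close> it also equals the sum of
  \<open>(w'\<^sub>i - w\<^sub>i)\<^sup>2 + 2 (w'\<^sub>i - w\<^sub>i) w\<^sub>i\<close>, and the second part is again nonnegative.
\<close>

lemma weyr_squares_gain:
  fixes w w' :: "nat \<Rightarrow> int" and h :: int and n :: nat
  assumes maj: "\<And>j. (\<Sum>i<j. w i) \<le> (\<Sum>i<j. w' i + h)"
    and mono: "\<And>i. w (Suc i) \<le> w i" "\<And>i. w' (Suc i) \<le> w' i"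
    and nonneg: "\<And>i. 0 \<le> w i" "\<And>i. 0 \<le> w' i"
  defines "S \<equiv> (\<Sum>i<n. (w' i)\<^sup>2) - (\<Sum>i<n. (w i)\<^sup>2) + h * ((\<Sum>i<n. w i) + (\<Sum>i<n. w' i))"
  shows "0 \<le> S" and "h = 0 \<Longrightarrow> S = 0 \<Longrightarrow> i < n \<Longrightarrow> w i = w' i"
proof -
  have part: "0 \<le> (\<Sum>i<j. w' i - w i + h)" for j
    using maj[of j] by (simp add: sum.distrib sum_subtractf)
  have "S = (\<Sum>i<n. (w' i - w i + h) * (w i + w' i))"
    unfolding S_def by (induction n) (simp_all add: algebra_simps power2_eq_square)
  then show "0 \<le> S"
    using abel_nonneg[of "\<lambda>i. w' i - w i + h" "\<lambda>i. w i + w' i" n] part mono nonneg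
    by (simp add: add_mono)
  assume h: "h = 0" and S: "S = 0" and i: "i < n"
  have "S = (\<Sum>i<n. (w' i - w i)\<^sup>2) + 2 * (\<Sum>i<n. (w' i - w i) * w i)"
    unfolding S_def h by (induction n) (simp_all add: algebra_simps power2_eq_square)
  moreover have "0 \<le> (\<Sum>i<n. (w' i - w i) * w i)"
    using abel_nonneg[of "\<lambda>i. w' i - w i" w n] part mono nonneg h by simp
  moreover have "0 \<le> (\<Sum>i<n. (w' i - w i)\<^sup>2)" by (intro sum_nonneg) simp
  ultimately have "(\<Sum>i<n. (w' i - w i)\<^sup>2) = 0" using S by linarith
  then have "(w' i - w i)\<^sup>2 = 0"
    using i by (subst (asm) sum_nonneg_eq_0_iff) auto
  then show "w i = w' i" by simp
qed

text \<open>
  Let \<open>Q\<^sub>j\<close> be the sum of \<open>r\<^sub>i + h - b\<^sub>i\<close> over \<open>i < j\<close>.  Summation by parts writes \<open>S\<close> as the sum of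
  \<open>Q\<^sub>j\<^sub>+\<^sub>1 (r\<^sub>j\<^sub>+\<^sub>1 - r\<^sub>j\<^sub>+\<^sub>2) + Q\<^sub>j\<^sub>+\<^sub>2 (b\<^sub>j - b\<^sub>j\<^sub>+\<^sub>1)\<close>, and both products are nonnegative.  The bound \<open>h\<^sup>2\<close> comes
  from the second one: \<open>b\<close> decreases from a value \<open>\<ge> h\<close> to \<open>0\<close>, and the further it falls below \<open>h\<close>, the
  larger \<open>Q\<close> becomes.  With \<open>c\<^sub>j = max (h - b\<^sub>j) 0\<close> one has \<open>Q\<^sub>j\<^sub>+\<^sub>2 \<ge> c\<^sub>j + c\<^sub>j\<^sub>+\<^sub>1\<close> and
  \<open>b\<^sub>j - b\<^sub>j\<^sub>+\<^sub>1 \<ge> c\<^sub>j\<^sub>+\<^sub>1 - c\<^sub>j\<close>, so the sum is at least the telescoping sum of \<open>c\<^sub>j\<^sub>+\<^sub>1\<^sup>2 - c\<^sub>j\<^sup>2\<close>.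

  In the case of equality, suppose that \<open>Q\<close> is positive for the first time at \<open>j + 2\<close>.  Then
  \<open>r\<^sub>j = b\<^sub>j = b\<^sub>j\<^sub>+\<^sub>1 < r\<^sub>j\<^sub>+\<^sub>1\<close>, against the monotonicity of \<open>r\<close>.
\<close>

lemma weyr_products_gain:
  fixes r b :: "nat \<Rightarrow> int" and h :: int and n :: nat
  assumes h: "0 \<le> h" and b0: "b 0 = r 0 + h"
    and maj: "\<And>j. (\<Sum>i<j. b i) \<le> (\<Sum>i<j. r i + h)"
    and mono: "\<And>i. r (Suc i) \<le> r i" "\<And>i. b (Suc i) \<le> b i"
    and nonneg: "\<And>i. 0 \<le> r i" "\<And>i. 0 \<le> b i"
    and zero: "\<And>i. n \<le> i \<Longrightarrow> r i = 0" "\<And>i. n \<le> i \<Longrightarrow> b i = 0"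
  defines "S \<equiv> (\<Sum>i<n. r i * r (Suc i)) - (\<Sum>i<n. b i * b (Suc i))
      + h * ((\<Sum>i<n. r (Suc i)) + (\<Sum>i<n. b i))"
  shows "h\<^sup>2 \<le> S" and "h = 0 \<Longrightarrow> S = 0 \<Longrightarrow> r i = b i"
proof -
  define Q where "Q j = (\<Sum>i<j. r i + h - b i)" for j
  have Q0: "0 \<le> Q j" for j using maj[of j] by (simp add: Q_def sum_subtractf)
  have QS: "Q (Suc j) = Q j + r j + h - b j" for j by (simp add: Q_def)
  have Q1: "Q 0 = 0" "Q (Suc 0) = 0" using b0 by (simp_all add: Q_def)
  define gain where "gain j = Q (Suc j) * (r (Suc j) - r (Suc (Suc j)))
      + Q (Suc (Suc j)) * (b j - b (Suc j))" for j
  have "(\<Sum>i<k. r i * r (Suc i)) - (\<Sum>i<k. b i * b (Suc i)) + h * ((\<Sum>i<k. r (Suc i)) + (\<Sum>i<k. b i))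
      = (\<Sum>j<k. gain j) + Q k * r (Suc k) + Q (Suc k) * b k" for k
  proof (induction k)
    case (Suc k)
    then show ?case by (simp add: gain_def QS algebra_simps)
  qed (simp add: Q1)
  then have S: "S = (\<Sum>j<n. gain j)" using zero by (simp add: S_def)
  have gain_ge: "Q (Suc (Suc j)) * (b j - b (Suc j)) \<le> gain j" for j
    using Q0[of "Suc j"] mono(1)[of "Suc j"] by (simp add: gain_def)
  define c where "c j = h - min (b j) h" for j
  have c0: "c 0 = 0" using b0 nonneg(1)[of 0] by (simp add: c_def)
  have cn: "c n = h" using zero(2)[of n] h by (simp add: c_def)
  have step: "c j + c (Suc j) \<le> Q (Suc (Suc j))" if "c j \<le> Q (Suc j)" for j
  proof (cases "b (Suc j) \<le> h")
    case True
    then show ?thesis using that QS[of "Suc j"] nonneg(1)[of "Suc j"] by (simp add: c_def)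
  next
    case False
    then show ?thesis using Q0[of "Suc (Suc j)"] mono(2)[of j] by (simp add: c_def)
  qed
  have cpos: "0 \<le> c j" for j by (simp add: c_def)
  have cQ: "c j \<le> Q (Suc j)" for j
  proof (induction j)
    case (Suc j)
    show ?case using step[OF Suc] cpos[of j] by linarith
  qed (simp add: c0 Q1)
  have "(c k)\<^sup>2 \<le> (\<Sum>j<k. gain j)" for k
  proof (induction k)
    case (Suc k)
    have "(c (Suc k))\<^sup>2 - (c k)\<^sup>2 = (c k + c (Suc k)) * (c (Suc k) - c k)"
      by (simp add: power2_eq_square algebra_simps)
    also have "\<dots> \<le> Q (Suc (Suc k)) * (b k - b (Suc k))"
    proof (rule mult_mono)
      show "c k + c (Suc k) \<le> Q (Suc (Suc k))" by (rule step[OF cQ])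
      show "c (Suc k) - c k \<le> b k - b (Suc k)" using mono(2)[of k] by (simp add: c_def min_def)
      show "0 \<le> Q (Suc (Suc k))" by (rule Q0)
      show "0 \<le> c (Suc k) - c k" using mono(2)[of k] by (simp add: c_def min_def)
    qed
    finally show ?case using Suc gain_ge[of k] by simp
  qed (simp add: c0)
  from this[of n] show "h\<^sup>2 \<le> S" unfolding S cn .
  assume h0: "h = 0" and S0: "S = 0"
  have tpos: "0 \<le> gain j" for j
    using gain_ge[of j] Q0[of "Suc (Suc j)"] mono(2)[of j]
    by (meson diff_ge_0_iff_ge mult_nonneg_nonneg order_trans)
  have t0: "gain j = 0" if "j < n" for j
    using S0 tpos that unfolding S by (subst (asm) sum_nonneg_eq_0_iff) auto
  have "Q j = 0 \<and> Q (Suc j) = 0" for j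
  proof (induction j)
    case (Suc j)
    have eq: "r j = b j" using Suc QS[of j] h0 by simp
    have Q2: "Q (Suc (Suc j)) = r (Suc j) - b (Suc j)" using Suc QS[of "Suc j"] h0 by simp
    have "Q (Suc (Suc j)) = 0"
    proof (cases "j < n")
      case True
      then have "Q (Suc (Suc j)) * (b j - b (Suc j)) \<le> 0"
        using gain_ge[of j] t0 by simp
      moreover have "0 \<le> Q (Suc (Suc j)) * (b j - b (Suc j))"
        using Q0 mono(2)[of j] by simp
      ultimately have "Q (Suc (Suc j)) = 0 \<or> b j = b (Suc j)" by simp
      then show ?thesis using Q2 eq mono(1)[of j] Q0[of "Suc (Suc j)"] by auto
    next
      case False
      then show ?thesis using Q2 zero by simp
    qed
    then show ?case using Suc by simp
  qed (simp add: Q1)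
  then show "r i = b i" using QS[of i] h0 by simp
qed

section \<open>Counting blocks\<close>

definition r_count :: "kblock list \<Rightarrow> nat \<Rightarrow> int" where
  "r_count bs i = int (length (filter (\<lambda>b. \<exists>k\<ge>i. b = RSing k) bs))"

definition l_count :: "kblock list \<Rightarrow> nat \<Rightarrow> int" where
  "l_count bs i = int (length (filter (\<lambda>b. \<exists>k\<ge>i. b = LSing k) bs))"

definition W_count :: "ecomplex \<Rightarrow> kblock list \<Rightarrow> nat \<Rightarrow> int" where
  "W_count \<mu> bs i = int (length (filter (\<lambda>b. \<exists>k\<ge>i. b = Jordan k \<mu>) bs))"

lemmas count_defs = r_count_def l_count_def W_count_def

lemma count_antimono:
  "r_count bs (Suc i) \<le> r_count bs i" "l_count bs (Suc i) \<le> l_count bs i"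
  "W_count \<mu> bs (Suc i) \<le> W_count \<mu> bs i"
  unfolding count_defs by (induction bs) (auto dest: Suc_leD)

lemma count_nonneg: "0 \<le> r_count bs i" "0 \<le> l_count bs i" "0 \<le> W_count \<mu> bs i"
  by (auto simp: count_defs)

lemma count_zero:
  assumes "\<forall>b \<in> set bs. block_rank b < i"
  shows "r_count bs i = 0" "l_count bs i = 0" "W_count \<mu> bs i = 0"
  using assms unfolding count_defs by (auto simp: filter_empty_conv)

lemma W_count_not_eigenvalue:
  assumes "\<And>k. Jordan k \<mu> \<notin> set bs" shows "W_count \<mu> bs i = 0"
  using assms unfolding W_count_def by (auto simp: filter_empty_conv)

lemma sum_indicator_less:
  assumes "k \<le> n" shows "(\<Sum>i<n. if i < k then 1 else 0 :: int) = int k"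
proof -
  have "{i. i < n \<and> i < k} = {..<k}" using assms by auto
  then show ?thesis by (simp flip: sum.inter_filter)
qed

text \<open>
  A block of rank \<open>k\<close> contributes \<open>1\<close> to the first \<open>k\<close> entries of its list (counted from index \<open>1\<close>),
  and its number of columns (rows) exceeds its rank by \<open>1\<close> for right (left) singular blocks only.
\<close>

lemma count_sums:
  assumes "\<forall>b \<in> set bs. block_rank b < n" "finite S" "\<forall>k \<mu>. Jordan k \<mu> \<in> set bs \<longrightarrow> \<mu> \<in> S"
  shows "int (sum_list (map block_rank bs)) =
      (\<Sum>i<n. r_count bs (Suc i)) + (\<Sum>i<n. l_count bs (Suc i)) + (\<Sum>\<mu>\<in>S. \<Sum>i<n. W_count \<mu> bs (Suc i))"
    and "int (sum_list (map (ncols \<circ> block_pencil) bs)) = int (sum_list (map block_rank bs)) + r_count bs 0"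
    and "int (sum_list (map (nrows \<circ> block_pencil) bs)) = int (sum_list (map block_rank bs)) + l_count bs 0"
proof -
  show "int (sum_list (map block_rank bs)) =
      (\<Sum>i<n. r_count bs (Suc i)) + (\<Sum>i<n. l_count bs (Suc i)) + (\<Sum>\<mu>\<in>S. \<Sum>i<n. W_count \<mu> bs (Suc i))"
    using assms
  proof (induction bs)
    case Nil
    then show ?case by (simp add: count_defs)
  next
    case (Cons b bs)
    have c: "r_count (b # bs) i = (if \<exists>k\<ge>i. b = RSing k then 1 else 0) + r_count bs i"
      "l_count (b # bs) i = (if \<exists>k\<ge>i. b = LSing k then 1 else 0) + l_count bs i"
      "W_count \<mu> (b # bs) i = (if \<exists>k\<ge>i. b = Jordan k \<mu> then 1 else 0) + W_count \<mu> bs i" for i \<mu>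
      by (auto simp: count_defs)
    have ind: "(\<Sum>i<n. if Suc i \<le> k then 1 else 0 :: int) = int k" if "k < n" for k
      using sum_indicator_less[of k n] that by (simp add: Suc_le_eq)
    have IH: "int (sum_list (map block_rank bs)) =
      (\<Sum>i<n. r_count bs (Suc i)) + (\<Sum>i<n. l_count bs (Suc i)) + (\<Sum>\<mu>\<in>S. \<Sum>i<n. W_count \<mu> bs (Suc i))"
      by (rule Cons.IH) (use Cons.prems in auto)
    have k: "block_rank b < n" using Cons.prems(1) by simp
    have "int (block_rank b) = (\<Sum>i<n. if \<exists>k\<ge>Suc i. b = RSing k then 1 else 0)
        + (\<Sum>i<n. if \<exists>k\<ge>Suc i. b = LSing k then 1 else 0)
        + (\<Sum>\<mu>\<in>S. \<Sum>i<n. if \<exists>k\<ge>Suc i. b = Jordan k \<mu> then 1 else 0)"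
    proof (cases b)
      case (Jordan k \<nu>)
      have "(\<Sum>\<mu>\<in>S. \<Sum>i<n. if \<exists>k\<ge>Suc i. b = Jordan k \<mu> then 1 else 0 :: int)
          = (\<Sum>\<mu>\<in>S. if \<mu> = \<nu> then int k else 0)"
        using ind[of k] k Jordan by (intro sum.cong) auto
      moreover have "\<nu> \<in> S" using Cons.prems(3) Jordan by auto
      ultimately show ?thesis using Cons.prems(2) Jordan by (simp add: sum.delta)
    next
      case (RSing k)
      then show ?thesis using ind[of k] k by simp
    next
      case (LSing k)
      then show ?thesis using ind[of k] k by simp
    qed
    then show ?case unfolding c sum.distrib using IH by simp
  qed
  show "int (sum_list (map (ncols \<circ> block_pencil) bs)) = int (sum_list (map block_rank bs)) + r_count bs 0"
  proof (induction bs)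
    case (Cons b bs)
    have "int (ncols (block_pencil b)) = int (block_rank b) + (if \<exists>k. b = RSing k then 1 else 0)"
      by (cases b rule: block_pencil.cases) (auto simp: ncols_def jordan_block_def)
    then show ?case using Cons by (simp add: r_count_def)
  qed (simp add: r_count_def)
  show "int (sum_list (map (nrows \<circ> block_pencil) bs)) = int (sum_list (map block_rank bs)) + l_count bs 0"
  proof (induction bs)
    case (Cons b bs)
    have "int (nrows (block_pencil b)) = int (block_rank b) + (if \<exists>k. b = LSing k then 1 else 0)"
      by (cases b rule: block_pencil.cases) (auto simp: nrows_def jordan_block_def)
    then show ?case using Cons by (simp add: l_count_def)
  qed (simp add: l_count_def)
qed

lemma weyr_counts:
  "r_weyr L i = r_count (kcf L) i" "l_weyr L i = l_count (kcf L) i" "W_weyr \<mu> L i = W_count \<mu> (kcf L) i"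
  by (simp_all add: r_weyr_def l_weyr_def W_weyr_def count_defs)

lemma orbit_codim_finite:
  assumes N: "\<forall>b \<in> set (kcf L). block_rank b < N" and S: "finite S"
    "\<forall>k \<mu>. Jordan k \<mu> \<in> set (kcf L) \<longrightarrow> \<mu> \<in> S"
  shows "orbit_codim L = l_weyr L 0 * int (ncols L) + r_weyr L 0 * int (nrows L)
     - (\<Sum>i<N. r_weyr L i * r_weyr L (Suc i)) - (\<Sum>i<N. l_weyr L i * l_weyr L (Suc i))
     + (\<Sum>\<mu>\<in>S. \<Sum>i<N. (W_weyr \<mu> L (Suc i))\<^sup>2)"
proof -
  have zero: "r_weyr L i = 0" "l_weyr L i = 0" "W_weyr \<mu> L i = 0" if "N \<le> i" for i \<mu>
    using N that unfolding weyr_counts by (fastforce intro!: count_zero)+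
  have "Sum_any (\<lambda>i. r_weyr L i * r_weyr L (i + 1)) = (\<Sum>i<N. r_weyr L i * r_weyr L (Suc i))"
    using zero by (subst Sum_any.expand_superset[where A = "{..<N}"]) (auto simp: not_less[symmetric])
  moreover have "Sum_any (\<lambda>i. l_weyr L i * l_weyr L (i + 1)) = (\<Sum>i<N. l_weyr L i * l_weyr L (Suc i))"
    using zero by (subst Sum_any.expand_superset[where A = "{..<N}"]) (auto simp: not_less[symmetric])
  moreover have inner: "Sum_any (\<lambda>i. if i \<ge> 1 then (W_weyr \<mu> L i)\<^sup>2 else 0) = (\<Sum>i<N. (W_weyr \<mu> L (Suc i))\<^sup>2)" for \<mu>
  proof -
    have "Sum_any (\<lambda>i. if i \<ge> 1 then (W_weyr \<mu> L i)\<^sup>2 else 0)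
        = (\<Sum>i<Suc N. if i \<ge> 1 then (W_weyr \<mu> L i)\<^sup>2 else 0)"
    proof (rule Sum_any.expand_superset)
      have "i < Suc N" if "W_weyr \<mu> L i \<noteq> 0" for i
        using zero(3)[of i \<mu>] that by (cases "N \<le> i") auto
      then show "{i. (if i \<ge> 1 then (W_weyr \<mu> L i)\<^sup>2 else 0) \<noteq> 0} \<subseteq> {..<Suc N}" by auto
    qed simp
    then show ?thesis by (simp only: sum.lessThan_Suc_shift) simp
  qed
  moreover have "Sum_any (\<lambda>\<mu>. \<Sum>i<N. (W_weyr \<mu> L (Suc i))\<^sup>2) = (\<Sum>\<mu>\<in>S. \<Sum>i<N. (W_weyr \<mu> L (Suc i))\<^sup>2)"
  proof (rule Sum_any.expand_superset[OF S(1)])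
    show "{\<mu>. (\<Sum>i<N. (W_weyr \<mu> L (Suc i))\<^sup>2) \<noteq> 0} \<subseteq> S"
    proof (rule subsetI, rule ccontr)
      fix \<mu> assume "\<mu> \<in> {\<mu>. (\<Sum>i<N. (W_weyr \<mu> L (Suc i))\<^sup>2) \<noteq> 0}" "\<mu> \<notin> S"
      moreover from this have "W_weyr \<mu> L i = 0" for i
        unfolding weyr_counts using S(2) by (intro W_count_not_eigenvalue) blast
      ultimately show False by simp
    qed
  qed
  ultimately show ?thesis unfolding orbit_codim_def by simp
qed

section \<open>The codimension inequality\<close>

theorem theorem4:
  fixes L M :: pencil and m n :: nat and h :: int
  assumes "L \<in> pencils m n" and "M \<in> pencils m n"
    and "pencil_rank M \<le> pencil_rank L"
    and "h = int (pencil_rank L) - int (pencil_rank M)"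
    and M1: "weak_major 0 (r_weyr M) (\<lambda>i. r_weyr L i + h)"
    and M2: "weak_major 0 (l_weyr M) (\<lambda>i. l_weyr L i + h)"
    and M3: "\<And>\<mu>. weak_major 1 (W_weyr \<mu> L) (\<lambda>i. W_weyr \<mu> M i + h)"
  shows "orbit_codim L \<le> orbit_codim M \<and>
    (orbit_codim L = orbit_codim M \<longleftrightarrow>
       h = 0 \<and> (\<forall>i. r_weyr M i = r_weyr L i) \<and> (\<forall>i. l_weyr M i = l_weyr L i) \<and>
       (\<forall>\<mu>. \<forall>i\<ge>1. W_weyr \<mu> L i = W_weyr \<mu> M i))"
proof -
  have kcf: "is_kcf X (kcf X)" if "X \<in> pencils m n" for X
    using kcf_exists[OF that] unfolding kcf_def by (rule someI_ex)
  note kL = kcf[OF assms(1)] and kM = kcf[OF assms(2)]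
  have dims: "nrows L = m" "ncols L = n" "nrows M = m" "ncols M = n"
    using assms(1,2) by (auto simp: pencils_def nrows_def ncols_def)
  have h: "0 \<le> h" using assms(3,4) by simp
  \<comment> \<open>All sums are cut off at a common \<open>N\<close> and \<open>S\<close>, beyond which the lists of \<open>L\<close> and \<open>M\<close> vanish.\<close>
  define bs where "bs = kcf L @ kcf M"
  define N where "N = Suc (Max (insert 0 (block_rank ` set bs)))"
  define S where "S = (\<lambda>b. case b of Jordan k \<mu> \<Rightarrow> \<mu> | _ \<Rightarrow> Infinity) ` set bs"
  have N: "\<forall>b \<in> set (kcf L). block_rank b < N" "\<forall>b \<in> set (kcf M). block_rank b < N"
    unfolding N_def bs_def by (auto simp: less_Suc_eq_le intro!: Max_ge)
  have S: "finite S" by (simp add: S_def)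
  have "\<mu> \<in> S" if "Jordan k \<mu> \<in> set bs" for k \<mu>
    using imageI[OF that, of "\<lambda>b. case b of Jordan k \<mu> \<Rightarrow> \<mu> | _ \<Rightarrow> Infinity"] by (simp add: S_def)
  then have SL: "\<forall>k \<mu>. Jordan k \<mu> \<in> set (kcf L) \<longrightarrow> \<mu> \<in> S"
    and SM: "\<forall>k \<mu>. Jordan k \<mu> \<in> set (kcf M) \<longrightarrow> \<mu> \<in> S"
    by (auto simp: bs_def)
  note sizesL = kcf_sizes[OF assms(1) kL] and sizesM = kcf_sizes[OF assms(2) kM]
  have sums: "int (pencil_rank L) = (\<Sum>i<N. r_weyr L (Suc i)) + (\<Sum>i<N. l_weyr L (Suc i))
        + (\<Sum>\<mu>\<in>S. \<Sum>i<N. W_weyr \<mu> L (Suc i))"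
    "int (pencil_rank M) = (\<Sum>i<N. r_weyr M (Suc i)) + (\<Sum>i<N. l_weyr M (Suc i))
        + (\<Sum>\<mu>\<in>S. \<Sum>i<N. W_weyr \<mu> M (Suc i))"
    unfolding sizesL(3) sizesM(3) weyr_counts
    by (rule count_sums(1)[OF N(1) S SL], rule count_sums(1)[OF N(2) S SM])
  have zeros: "int n = int (pencil_rank L) + r_weyr L 0" "int m = int (pencil_rank L) + l_weyr L 0"
    "int n = int (pencil_rank M) + r_weyr M 0" "int m = int (pencil_rank M) + l_weyr M 0"
    using count_sums(2,3)[OF N(1) S SL] count_sums(2,3)[OF N(2) S SM] sizesL sizesM
    unfolding weyr_counts by simp_all
  have shift: "(\<Sum>i<N. r_weyr M i) = (\<Sum>i<N. r_weyr M (Suc i)) + r_weyr M 0"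
    "(\<Sum>i<N. l_weyr M i) = (\<Sum>i<N. l_weyr M (Suc i)) + l_weyr M 0"
  proof -
    have "r_weyr M N = 0" "l_weyr M N = 0" using count_zero[OF N(2)] by (simp_all add: weyr_counts)
    then show "(\<Sum>i<N. r_weyr M i) = (\<Sum>i<N. r_weyr M (Suc i)) + r_weyr M 0"
      "(\<Sum>i<N. l_weyr M i) = (\<Sum>i<N. l_weyr M (Suc i)) + l_weyr M 0"
      using sum.lessThan_Suc_shift[of "r_weyr M" N] sum.lessThan_Suc_shift[of "l_weyr M" N] by simp_all
  qed
  have mono: "r_weyr X (Suc i) \<le> r_weyr X i" "l_weyr X (Suc i) \<le> l_weyr X i"
    "W_weyr \<mu> X (Suc i) \<le> W_weyr \<mu> X i" for X i \<mu>
    unfolding weyr_counts by (rule count_antimono)+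
  have nonneg: "0 \<le> r_weyr X i" "0 \<le> l_weyr X i" "0 \<le> W_weyr \<mu> X i" for X i \<mu>
    unfolding weyr_counts by (rule count_nonneg)+
  have zero: "r_weyr L i = 0" "l_weyr L i = 0" "r_weyr M i = 0" "l_weyr M i = 0"
    "W_weyr \<mu> L i = 0" "W_weyr \<mu> M i = 0" if "N \<le> i" for i \<mu>
    using N that unfolding weyr_counts by (fastforce intro!: count_zero)+
  have zero_W: "W_weyr \<mu> L i = 0" "W_weyr \<mu> M i = 0" if "\<mu> \<notin> S" for \<mu> i
    unfolding weyr_counts using SL SM that by (blast intro: W_count_not_eigenvalue)+
  have majr: "(\<Sum>i<j. r_weyr M i) \<le> (\<Sum>i<j. r_weyr L i + h)" for j
    using M1 by (cases j) (simp_all add: weak_major_def atMost_atLeast0 lessThan_Suc_atMost)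
  have majl: "(\<Sum>i<j. l_weyr M i) \<le> (\<Sum>i<j. l_weyr L i + h)" for j
    using M2 by (cases j) (simp_all add: weak_major_def atMost_atLeast0 lessThan_Suc_atMost)
  have majW: "(\<Sum>i<j. W_weyr \<mu> L (Suc i)) \<le> (\<Sum>i<j. W_weyr \<mu> M (Suc i) + h)" for j \<mu>
  proof (cases j)
    case (Suc k)
    have "(\<Sum>i = 1..Suc k. W_weyr \<mu> L i) \<le> (\<Sum>i = 1..Suc k. W_weyr \<mu> M i + h)"
      by (rule M3[unfolded weak_major_def, rule_format]) simp
    then show ?thesis
      unfolding Suc One_nat_def sum.shift_bounds_cl_Suc_ivl by (simp add: atMost_atLeast0 lessThan_Suc_atMost)
  qed simp
  define Gr where "Gr = (\<Sum>i<N. r_weyr L i * r_weyr L (Suc i)) - (\<Sum>i<N. r_weyr M i * r_weyr M (Suc i))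
      + h * ((\<Sum>i<N. r_weyr L (Suc i)) + (\<Sum>i<N. r_weyr M i))"
  define Gl where "Gl = (\<Sum>i<N. l_weyr L i * l_weyr L (Suc i)) - (\<Sum>i<N. l_weyr M i * l_weyr M (Suc i))
      + h * ((\<Sum>i<N. l_weyr L (Suc i)) + (\<Sum>i<N. l_weyr M i))"
  define GW where "GW \<mu> = (\<Sum>i<N. (W_weyr \<mu> M (Suc i))\<^sup>2) - (\<Sum>i<N. (W_weyr \<mu> L (Suc i))\<^sup>2)
      + h * ((\<Sum>i<N. W_weyr \<mu> L (Suc i)) + (\<Sum>i<N. W_weyr \<mu> M (Suc i)))" for \<mu>
  have b0: "r_weyr M 0 = r_weyr L 0 + h" "l_weyr M 0 = l_weyr L 0 + h"
    using zeros assms(4) by simp_all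
  have Gr: "h\<^sup>2 \<le> Gr" "h = 0 \<Longrightarrow> Gr = 0 \<Longrightarrow> r_weyr L i = r_weyr M i" for i
    unfolding Gr_def using weyr_products_gain[OF h b0(1) majr mono(1,1) nonneg(1,1) zero(1,3)] by blast+
  have Gl: "h\<^sup>2 \<le> Gl" "h = 0 \<Longrightarrow> Gl = 0 \<Longrightarrow> l_weyr L i = l_weyr M i" for i
    unfolding Gl_def using weyr_products_gain[OF h b0(2) majl mono(2,2) nonneg(2,2) zero(2,4)] by blast+
  have GW: "0 \<le> GW \<mu>" "h = 0 \<Longrightarrow> GW \<mu> = 0 \<Longrightarrow> i < N \<Longrightarrow> W_weyr \<mu> L (Suc i) = W_weyr \<mu> M (Suc i)" for \<mu> i
    unfolding GW_def using weyr_squares_gain[OF majW mono(3,3) nonneg(3,3)] by blast+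
  note codim = orbit_codim_finite[OF N(1) S SL] orbit_codim_finite[OF N(2) S SM]
  have sumGW: "(\<Sum>\<mu>\<in>S. GW \<mu>) = (\<Sum>\<mu>\<in>S. \<Sum>i<N. (W_weyr \<mu> M (Suc i))\<^sup>2) - (\<Sum>\<mu>\<in>S. \<Sum>i<N. (W_weyr \<mu> L (Suc i))\<^sup>2)
      + h * ((\<Sum>\<mu>\<in>S. \<Sum>i<N. W_weyr \<mu> L (Suc i)) + (\<Sum>\<mu>\<in>S. \<Sum>i<N. W_weyr \<mu> M (Suc i)))"
    unfolding GW_def by (simp add: sum.distrib sum_subtractf sum_distrib_left distrib_left)
  have diff: "orbit_codim M - orbit_codim L = Gr + Gl + (\<Sum>\<mu>\<in>S. GW \<mu>) - h\<^sup>2"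
  proof -
    \<comment> \<open>The sums over \<open>L\<close> add up to its rank; those over \<open>M\<close>, where \<open>r\<close> and \<open>\<ell>\<close> start at index 0, to
      \<open>rank M + (n - rank M) + (m - rank M)\<close>.\<close>
    have total: "(\<Sum>i<N. r_weyr L (Suc i)) + (\<Sum>i<N. r_weyr M i) + (\<Sum>i<N. l_weyr L (Suc i)) + (\<Sum>i<N. l_weyr M i)
        + (\<Sum>\<mu>\<in>S. \<Sum>i<N. W_weyr \<mu> L (Suc i)) + (\<Sum>\<mu>\<in>S. \<Sum>i<N. W_weyr \<mu> M (Suc i)) = int n + int m + h"
      using sums shift zeros assms(4) by linarith
    have "orbit_codim M - orbit_codim L = h * int n + h * int m
        + (Gr - h * ((\<Sum>i<N. r_weyr L (Suc i)) + (\<Sum>i<N. r_weyr M i)))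
        + (Gl - h * ((\<Sum>i<N. l_weyr L (Suc i)) + (\<Sum>i<N. l_weyr M i)))
        + ((\<Sum>\<mu>\<in>S. GW \<mu>) - h * ((\<Sum>\<mu>\<in>S. \<Sum>i<N. W_weyr \<mu> L (Suc i)) + (\<Sum>\<mu>\<in>S. \<Sum>i<N. W_weyr \<mu> M (Suc i))))"
      unfolding codim sumGW Gr_def Gl_def dims b0 by (simp add: distrib_right)
    also have "\<dots> = Gr + Gl + (\<Sum>\<mu>\<in>S. GW \<mu>) + h * (int n + int m)
        - h * ((\<Sum>i<N. r_weyr L (Suc i)) + (\<Sum>i<N. r_weyr M i) + (\<Sum>i<N. l_weyr L (Suc i)) + (\<Sum>i<N. l_weyr M i)
        + (\<Sum>\<mu>\<in>S. \<Sum>i<N. W_weyr \<mu> L (Suc i)) + (\<Sum>\<mu>\<in>S. \<Sum>i<N. W_weyr \<mu> M (Suc i)))"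
      by (simp add: distrib_left)
    also have "\<dots> = Gr + Gl + (\<Sum>\<mu>\<in>S. GW \<mu>) - h\<^sup>2"
      unfolding total by (simp add: distrib_left power2_eq_square)
    finally show ?thesis .
  qed
  have GWsum: "0 \<le> (\<Sum>\<mu>\<in>S. GW \<mu>)" using GW(1) by (rule sum_nonneg)
  have ge: "h\<^sup>2 \<le> orbit_codim M - orbit_codim L" using diff Gr(1) Gl(1) GWsum by linarith
  have eqI: "h = 0 \<and> (\<forall>i. r_weyr M i = r_weyr L i) \<and> (\<forall>i. l_weyr M i = l_weyr L i) \<and>
       (\<forall>\<mu>. \<forall>i\<ge>1. W_weyr \<mu> L i = W_weyr \<mu> M i)" if eq: "orbit_codim L = orbit_codim M"
  proof -
    have h0: "h = 0" using ge eq by simp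
    then have "Gr = 0" "Gl = 0" and GW0: "(\<Sum>\<mu>\<in>S. GW \<mu>) = 0"
      using diff eq Gr(1) Gl(1) GWsum by simp_all
    then have "\<forall>i. r_weyr M i = r_weyr L i" "\<forall>i. l_weyr M i = l_weyr L i"
      using Gr(2) Gl(2) h0 by auto
    moreover have "W_weyr \<mu> L i = W_weyr \<mu> M i" if i: "i \<ge> 1" for \<mu> i
    proof (cases "\<mu> \<in> S \<and> i < N")
      case True
      then have "GW \<mu> = 0" using GW0 GW(1) S by (simp add: sum_nonneg_eq_0_iff)
      moreover have "i - 1 < N" "Suc (i - 1) = i" using True i by auto
      ultimately show ?thesis using GW(2)[OF h0, of \<mu> "i - 1"] by simp
    next
      case False
      then show ?thesis using zero(5,6)[of i] zero_W[of \<mu> i] by auto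
    qed
    ultimately show ?thesis using h0 by blast
  qed
  have "orbit_codim L = orbit_codim M"
    if "h = 0 \<and> (\<forall>i. r_weyr M i = r_weyr L i) \<and> (\<forall>i. l_weyr M i = l_weyr L i) \<and>
       (\<forall>\<mu>. \<forall>i\<ge>1. W_weyr \<mu> L i = W_weyr \<mu> M i)"
    unfolding codim dims using that by simp
  moreover have "orbit_codim L \<le> orbit_codim M" using ge by (meson diff_ge_0_iff_ge order_trans zero_le_power2)
  ultimately show ?thesis using eqI by blast
qed

end
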